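(* Consider the problem $\min_{x\in\mathbb{R}^d}\{P(x)=\frac1n\sum_{i=1}^n f_i(x)+\psi(x)\}$, and write $f=\frac1n\sum_{i=1}^n f_i$. Suppose $f$ is $\mu$-strongly convex ($\mu>0$) and that the functions $f_i$ have $L$-Lipschitz continuous gradient for all $i$. Further, let the compression operators used be $\omega$-compression operators. Choose the parameters of ADIANA (defined in the context) as follows: $$\eta=\min\Big\{\frac1{2L},\frac{n}{64\omega(2p(\omega+1)+1)^2L}\Big\},\quad \theta_1=\min\Big\{\frac14,\sqrt{\frac{\eta\mu}{p}}\Big\},\quad \theta_2=\frac12,$$ $$\alpha=\frac1{\omega+1},\quad \beta=1-\gamma\mu,\quad \gamma=\frac{\eta}{2(\theta_1+\eta\mu)},\quad p=\min\Big\{1,\frac{\max\{1,\sqrt{\frac{n}{32\omega}}-1\}}{2(1+\omega)}\Big\}.$$ Then the number of iterations performed by ADIANA to find an $\epsilon$-solution such that $\mathbb{E}[\|z^k-x^*\|^2]\le\epsilon$ is at most $$k=\begin{cases}O\Big(\Big[\omega+\omega\sqrt{\frac{L}{n\mu}}\,\Big]\log\frac1\epsilon\Big), & n\le\omega,\\[2mm] O\Big(\Big[\omega+\sqrt{\frac L\mu}+\sqrt{\sqrt{\frac\omega n}\,\frac{\omega L}{\mu}}\,\Big]\log\frac1\epsilon\Big), & n>\omega.\end{cases}$$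
   Context: $\|\cdot\|$ is the Euclidean norm. Here $n$ is the number of devices, each $f_i:\mathbb{R}^d\to\mathbb{R}$ is a smooth loss associated with the data on device $i$, $\psi:\mathbb{R}^d\to\mathbb{R}\cup\{+\infty\}$ is a relatively simple but possibly nonsmooth regularizer, and $x^*$ is the minimizer of $P$. A function $f$ is $\mu$-strongly convex if $f(x)-f(y)-\langle\nabla f(y),x-y\rangle\ge\frac\mu2\|x-y\|^2$ for all $x,y\in\mathbb{R}^d$; its gradient is $L$-Lipschitz continuous if $\|\nabla f(x)-\nabla f(y)\|\le L\|x-y\|$ for all $x,y\in\mathbb{R}^d$. A randomized map $\mathcal{C}:\mathbb{R}^d\to\mathbb{R}^d$ is an $\omega$-compression operator if $\mathbb{E}[\mathcal{C}(x)]=x$ and $\mathbb{E}[\|\mathcal{C}(x)-x\|^2]\le\omega\|x\|^2$ for all $x\in\mathbb{R}^d$ (where $\omega\ge0$). $\mathrm{prox}_{\eta\psi}(v)=\arg\min_{u}\{\frac12\|u-v\|^2+\eta\psi(u)\}$. ADIANA. Input: initial point $x^0$, vectors $h_1^0,\dots,h_n^0$, $h^0=\frac1n\sum_{i=1}^n h_i^0$, parameters $\eta,\theta_1,\theta_2,\alpha,\beta,\gamma,p$. Set $z^0=y^0=w^0=x^0$. For $k=0,1,2,\dots$: 1. $x^k=\theta_1z^k+\theta_2w^k+(1-\theta_1-\theta_2)y^k$; 2. for all machines $i=1,\dots,n$ in parallel: compress the shifted local gradient $\mathcal{C}_i^k(\nabla f_i(x^k)-h_i^k)$ and send it to the server;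 update the local shift $h_i^{k+1}=h_i^k+\alpha\,\mathcal{C}_i^k(\nabla f_i(w^k)-h_i^k)$; 3. $g^k=\frac1n\sum_{i=1}^n\mathcal{C}_i^k(\nabla f_i(x^k)-h_i^k)+h^k$ and $h^{k+1}=h^k+\alpha\frac1n\sum_{i=1}^n\mathcal{C}_i^k(\nabla f_i(w^k)-h_i^k)$; 4. $y^{k+1}=\mathrm{prox}_{\eta\psi}(x^k-\eta g^k)$; 5. $z^{k+1}=\beta z^k+(1-\beta)x^k+\frac\gamma\eta(y^{k+1}-x^k)$; 6. $w^{k+1}=y^k$ with probability $p$, and $w^{k+1}=w^k$ with probability $1-p$. Here the $\mathcal{C}_i^k$ are the compression operators.
   Formalization: Each f_i is additionally assumed convex (otherwise the claim fails, e.g. n=2, f_1=(L/2)x^2, f_2=(mu-L/2)x^2, dropout compressors with omega=2, mu/L tiny), and psi is assumed proper, closed and convex (psi=-(c/2)x^2 with c near mu breaks the rate). *)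

theory Defs
  imports "HOL-Probability.Probability"
begin

definition proper_closed_convex :: "('a::euclidean_space \<Rightarrow> ereal) \<Rightarrow> bool" where
  "proper_closed_convex \<psi> \<longleftrightarrow>
     (\<forall>x. \<psi> x \<noteq> -\<infinity>) \<and> (\<exists>x. \<psi> x \<noteq> \<infinity>) \<and>
     closed {(x, r :: real). \<psi> x \<le> ereal r} \<and> convex {(x, r :: real). \<psi> x \<le> ereal r}"

definition strongly_convex ::
    "real \<Rightarrow> ('a::euclidean_space \<Rightarrow> real) \<Rightarrow> ('a \<Rightarrow> 'a) \<Rightarrow> bool" where
  "strongly_convex \<mu> f gradf \<longleftrightarrow>
     (\<forall>x. GDERIV f x :> gradf x) \<and>
     (\<forall>x y. f x - f y - inner (gradf y) (x - y) \<ge> \<mu> / 2 * (norm (x - y))\<^sup>2)"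

definition prox :: "real \<Rightarrow> ('a::euclidean_space \<Rightarrow> ereal) \<Rightarrow> 'a \<Rightarrow> 'a" where
  "prox \<eta> \<psi> v = arg_min (\<lambda>u. ereal ((norm (u - v))\<^sup>2 / 2) + ereal \<eta> * \<psi> u) (\<lambda>_. True)"

text \<open>
  A randomized map is a family of maps \<open>C s\<close> indexed by the sample points \<open>s\<close> of a probability
  space. The second moment is a nonnegative integral, so that the bound entails its finiteness.
\<close>

definition compression_operator ::
    "real \<Rightarrow> 's measure \<Rightarrow> ('s \<Rightarrow> 'a::euclidean_space \<Rightarrow> 'a) \<Rightarrow> bool" where
  "compression_operator \<omega> M C \<longleftrightarrow>
     (\<forall>x. integrable M (\<lambda>s. C s x) \<and> (\<integral>s. C s x \<partial>M) = x \<and>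
          (\<integral>\<^sup>+s. ennreal ((norm (C s x - x))\<^sup>2) \<partial>M) \<le> ennreal (\<omega> * (norm x)\<^sup>2))"

record 'a adiana_state =
  zvec :: 'a
  yvec :: 'a
  wvec :: 'a
  shift :: "nat \<Rightarrow> 'a"
  server_shift :: 'a

definition adiana_init :: "nat \<Rightarrow> 'a::euclidean_space \<Rightarrow> (nat \<Rightarrow> 'a) \<Rightarrow> 'a adiana_state" where
  "adiana_init n x0 h0 =
     \<lparr>zvec = x0, yvec = x0, wvec = x0, shift = h0,
      server_shift = (1 / real n) *\<^sub>R (\<Sum>i<n. h0 i)\<rparr>"

text \<open>
  One iteration for given realizations \<open>C i\<close> of the compressors and \<open>b\<close> of the coin.
  The machines are numbered from \<open>0\<close> to \<open>n - 1\<close>.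
\<close>

definition adiana_step ::
    "nat \<Rightarrow> (nat \<Rightarrow> 'a::euclidean_space \<Rightarrow> 'a) \<Rightarrow> ('a \<Rightarrow> ereal) \<Rightarrow>
     real \<Rightarrow> real \<Rightarrow> real \<Rightarrow> real \<Rightarrow> real \<Rightarrow> real \<Rightarrow>
     (nat \<Rightarrow> 'a \<Rightarrow> 'a) \<Rightarrow> bool \<Rightarrow> 'a adiana_state \<Rightarrow> 'a adiana_state" where
  "adiana_step n gradf \<psi> \<eta> \<theta>\<^sub>1 \<theta>\<^sub>2 \<alpha> \<beta> \<gamma> C b st =
     (let z = zvec st; y = yvec st; w = wvec st; h = shift st; hs = server_shift st;
          x = \<theta>\<^sub>1 *\<^sub>R z + \<theta>\<^sub>2 *\<^sub>R w + (1 - \<theta>\<^sub>1 - \<theta>\<^sub>2) *\<^sub>R y;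
          g = (1 / real n) *\<^sub>R (\<Sum>i<n. C i (gradf i x - h i)) + hs;
          y' = prox \<eta> \<psi> (x - \<eta> *\<^sub>R g)
      in \<lparr>zvec = \<beta> *\<^sub>R z + (1 - \<beta>) *\<^sub>R x + (\<gamma> / \<eta>) *\<^sub>R (y' - x),
          yvec = y',
          wvec = (if b then y else w),
          shift = (\<lambda>i. h i + \<alpha> *\<^sub>R C i (gradf i w - h i)),
          server_shift = hs + (\<alpha> / real n) *\<^sub>R (\<Sum>i<n. C i (gradf i w - h i))\<rparr>)"

primrec adiana ::
    "nat \<Rightarrow> (nat \<Rightarrow> 'a::euclidean_space \<Rightarrow> 'a) \<Rightarrow> ('a \<Rightarrow> ereal) \<Rightarrow>
     real \<Rightarrow> real \<Rightarrow> real \<Rightarrow> real \<Rightarrow> real \<Rightarrow> real \<Rightarrow>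
     (nat \<Rightarrow> nat \<Rightarrow> 'a \<Rightarrow> 'a) \<Rightarrow> (nat \<Rightarrow> bool) \<Rightarrow> 'a \<Rightarrow> (nat \<Rightarrow> 'a) \<Rightarrow>
     nat \<Rightarrow> 'a adiana_state" where
  "adiana n gradf \<psi> \<eta> \<theta>\<^sub>1 \<theta>\<^sub>2 \<alpha> \<beta> \<gamma> C b x0 h0 0 = adiana_init n x0 h0"
| "adiana n gradf \<psi> \<eta> \<theta>\<^sub>1 \<theta>\<^sub>2 \<alpha> \<beta> \<gamma> C b x0 h0 (Suc k) =
     adiana_step n gradf \<psi> \<eta> \<theta>\<^sub>1 \<theta>\<^sub>2 \<alpha> \<beta> \<gamma> (\<lambda>i. C i k) (b k)
       (adiana n gradf \<psi> \<eta> \<theta>\<^sub>1 \<theta>\<^sub>2 \<alpha> \<beta> \<gamma> C b x0 h0 k)"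

text \<open>
  For \<open>\<omega> = 0\<close> (no compression) the quotients by \<open>\<omega>\<close> in \<open>p\<close> and \<open>\<eta>\<close> stand for \<open>\<infinity>\<close>, whereas
  division by zero yields zero in HOL; hence the case distinctions.
\<close>

definition adiana_p :: "nat \<Rightarrow> real \<Rightarrow> real" where
  "adiana_p n \<omega> =
     (if \<omega> = 0 then 1
      else min 1 (max 1 (sqrt (real n / (32 * \<omega>)) - 1) / (2 * (1 + \<omega>))))"

definition adiana_eta :: "nat \<Rightarrow> real \<Rightarrow> real \<Rightarrow> real" where
  "adiana_eta n \<omega> L =
     (if \<omega> = 0 then 1 / (2 * L)
      else min (1 / (2 * L))
               (real n / (64 * \<omega> * (2 * adiana_p n \<omega> * (\<omega> + 1) + 1)\<^sup>2 * L)))"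

text \<open>
  The randomness of a run: \<open>\<xi> i k\<close> is the random seed, with values in the space \<open>S i k\<close>, which the
  compressor of machine \<open>i\<close> uses in iteration \<open>k\<close>, and \<open>b k\<close> is the coin deciding whether \<open>w\<close> is
  refreshed in iteration \<open>k\<close>. All of them are mutually independent. Seeds and coins have different
  value types, so independence is that of the generated families of events, which is what
  \<open>indep_vars\<close> unfolds to.
\<close>

definition independent_randomness ::
    "'w measure \<Rightarrow> nat \<Rightarrow> (nat \<Rightarrow> nat \<Rightarrow> 's measure) \<Rightarrow> (nat \<Rightarrow> nat \<Rightarrow> 'w \<Rightarrow> 's) \<Rightarrow>
     (nat \<Rightarrow> 'w \<Rightarrow> bool) \<Rightarrow> bool" where
  "independent_randomness M n S \<xi> b \<longleftrightarrow>
     (\<forall>i<n. \<forall>k. \<xi> i k \<in> measurable M (S i k)) \<and>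
     (\<forall>k. b k \<in> measurable M (count_space UNIV)) \<and>
     prob_space.indep_sets M
       (\<lambda>j. case j of
              Inl (i, k) \<Rightarrow> {\<xi> i k -` A \<inter> space M | A. A \<in> sets (S i k)}
            | Inr k \<Rightarrow> {b k -` B \<inter> space M | B. B \<in> sets (count_space UNIV)})
       (({..<n} \<times> UNIV) <+> UNIV)"

end

theory Submission
  imports Defs
begin

text \<open>
  With the gradient mapping \<open>G = (x - y') / \<eta>\<close> the update of \<open>z\<close> is a proximal step on
  \<open>\<langle>G, u\<rangle> + \<mu>/2 * |u - x|^2\<close>, so that the three-point inequality for this step, the subgradient
  inequality for \<open>y'\<close> and the descent lemma bound
  \<open>P y' - P x* + \<theta> / (2 \<gamma>) * |z' - x*|^2\<close> by a contraction of the old quantities, minus Bregman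
  distances of \<open>w\<close> and \<open>y\<close> from \<open>x\<close>, plus the compression variance. The latter is controlled by the
  shift error \<open>1/n * sum_i |h_i - \<nabla>f_i w|^2\<close> and, through cocoercivity, by these Bregman distances;
  the bound on \<open>\<eta>\<close> makes the latter cancel. Adding the gap at \<open>w\<close> and the shift error with suitable
  weights yields a Lyapunov function that decreases in expectation by the factor \<open>1 - \<rho>\<close> with
  \<open>\<rho> = min (2/5 * p * \<theta>) (1 / (4 * (\<omega> + 1)))\<close>.

  The starting point may satisfy \<open>\<psi> x0 = \<infinity>\<close>, and then \<open>w\<close> keeps an infinite gap with positive
  probability forever. Therefore the gaps are taken at reference points \<open>r\<close> and \<open>s\<close> in the domain of
  \<open>\<psi>\<close>, which start at \<open>x*\<close> and are refreshed together with \<open>w\<close> and \<open>y\<close>; the squared distances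
  \<open>|w - r|^2\<close> and \<open>|y - s|^2\<close> enter the Lyapunov function as well.

  Expectations over one iteration given the past are integrals over a second, independent copy of
  the sample point: the iterates are measurable for the \<open>\<sigma>\<close>-algebra of the past seeds and
  coins, which is independent of the one generated by the current ones.
\<close>

section \<open>Smooth convex functions and proximal maps\<close>

lemma GDERIV_line:
  fixes f :: "'a::euclidean_space \<Rightarrow> real"
  assumes "\<And>x. GDERIV f x :> g x"
  shows "((\<lambda>t. f (x + t *\<^sub>R d)) has_real_derivative inner (g (x + t *\<^sub>R d)) d) (at t within T)"
proof -
  have f: "(f has_derivative (\<lambda>h. inner h (g (x + t *\<^sub>R d)))) (at (x + t *\<^sub>R d))"
    using assms by (simp add: gderiv_def)
  have "((\<lambda>t. x + t *\<^sub>R d) has_derivative (\<lambda>h. h *\<^sub>R d)) (at t within T)"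
    by (auto intro!: derivative_eq_intros)
  from has_derivative_compose[OF this f] show ?thesis
    by (simp add: has_field_derivative_def inner_commute mult_commute_abs)
qed

text \<open>Restricted to the line through \<open>x\<close> and \<open>u\<close>, this is the
  tangent inequality for convex functions of one real variable.\<close>

lemma convex_on_above_tangent:
  fixes f :: "'a::euclidean_space \<Rightarrow> real"
  assumes "convex_on UNIV f" and "\<And>x. GDERIV f x :> g x"
  shows "f x + inner (g x) (u - x) \<le> f u"
proof -
  let ?h = "\<lambda>t. f (x + t *\<^sub>R (u - x))"
  have "convex_on UNIV ?h"
  proof (rule convex_onI)
    fix t a b :: real assume t: "0 < t" "t < 1"
    have "x + ((1 - t) *\<^sub>R a + t *\<^sub>R b) *\<^sub>R (u - x)
        = (1 - t) *\<^sub>R (x + a *\<^sub>R (u - x)) + t *\<^sub>R (x + b *\<^sub>R (u - x))"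
      by (simp add: algebra_simps)
    with convex_onD[OF assms(1), of t "x + a *\<^sub>R (u - x)" "x + b *\<^sub>R (u - x)"] t
    show "?h ((1 - t) *\<^sub>R a + t *\<^sub>R b) \<le> (1 - t) * ?h a + t * ?h b" by simp
  qed simp
  from convex_on_imp_above_tangent[OF this, of 0 1 "inner (g x) (u - x)"]
    GDERIV_line[OF assms(2), of x "u - x" 0 UNIV]
  show ?thesis by simp
qed

text \<open>Along the segment from \<open>x\<close> to \<open>u\<close>, the left side minus the
  right side is nonincreasing: Cauchy-Schwarz and the Lipschitz bound keep its derivative
  nonpositive.\<close>

lemma lipschitz_gradient_descent:
  fixes f :: "'a::euclidean_space \<Rightarrow> real"
  assumes "\<And>x. GDERIV f x :> g x" and "L-lipschitz_on UNIV g"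
  shows "f u \<le> f x + inner (g x) (u - x) + L / 2 * (norm (u - x))\<^sup>2"
proof -
  define d where "d = u - x"
  let ?h = "\<lambda>t. f (x + t *\<^sub>R d) - t * inner (g x) d - L / 2 * t\<^sup>2 * (norm d)\<^sup>2"
  have "?h 1 \<le> ?h 0"
  proof (rule DERIV_nonpos_imp_nonincreasing[where f = ?h])
    fix t :: real assume t: "0 \<le> t" "t \<le> 1"
    have D: "(?h has_real_derivative inner (g (x + t *\<^sub>R d)) d - inner (g x) d - L * t * (norm d)\<^sup>2) (at t)"
      by (auto intro!: derivative_eq_intros GDERIV_line[OF assms(1)])
    have "inner (g (x + t *\<^sub>R d)) d - inner (g x) d \<le> norm (g (x + t *\<^sub>R d) - g x) * norm d"
      by (metis inner_diff_left norm_cauchy_schwarz)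
    also have "\<dots> \<le> (L * (t * norm d)) * norm d"
      using lipschitz_onD[OF assms(2), of "x + t *\<^sub>R d" x] t
      by (intro mult_right_mono) (auto simp: dist_norm)
    finally have "inner (g (x + t *\<^sub>R d)) d - inner (g x) d - L * t * (norm d)\<^sup>2 \<le> 0"
      by (simp add: power2_eq_square mult.assoc)
    with D show "\<exists>y. (?h has_real_derivative y) (at t) \<and> y \<le> 0" by blast
  qed simp
  then show ?thesis by (simp add: d_def)
qed

lemma cocoercive_gradient:
  fixes f :: "'a::euclidean_space \<Rightarrow> real"
  assumes "convex_on UNIV f" and "\<And>x. GDERIV f x :> g x" and "L-lipschitz_on UNIV g" and "L > 0"
  shows "(norm (g x - g y))\<^sup>2 \<le> 2 * L * (f y - f x - inner (g x) (y - x))"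
proof -
  define e where "e = g y - g x"
  \<comment> \<open>A gradient step from \<open>y\<close> on \<open>f\<close> minus its tangent at
    \<open>x\<close>. It minimizes the quadratic upper bound at \<open>y\<close> minus that tangent,
    so comparing the two bounds at \<open>u\<close> gains
    \<open>(norm e)\<^sup>2 / (2 * L)\<close>.\<close>
  define u where "u = y - (1 / L) *\<^sub>R e"
  have "f x + inner (g x) (u - x) \<le> f u"
    by (rule convex_on_above_tangent[OF assms(1,2)])
  also have "\<dots> \<le> f y + inner (g y) (u - y) + L / 2 * (norm (u - y))\<^sup>2"
    by (rule lipschitz_gradient_descent[OF assms(2,3)])
  finally have "f x + inner (g x) (u - x) \<le> f y + inner (g y) (u - y) + L / 2 * (norm (u - y))\<^sup>2" .
  moreover have "inner (g y) (u - y) - inner (g x) (u - x)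
      = - inner (g x) (y - x) - (1 / L) * (norm e)\<^sup>2"
    unfolding u_def e_def power2_norm_eq_inner by (simp add: algebra_simps inner_commute)
  moreover have "L / 2 * (norm (u - y))\<^sup>2 = (1 / L) * (norm e)\<^sup>2 / 2"
    using \<open>L > 0\<close> by (simp add: u_def field_simps power2_eq_square)
  ultimately have "(1 / L) * (norm e)\<^sup>2 / 2 \<le> f y - f x - inner (g x) (y - x)" by linarith
  then have "(norm (g y - g x))\<^sup>2 \<le> 2 * L * (f y - f x - inner (g x) (y - x))"
    using \<open>L > 0\<close> by (simp add: e_def field_simps)
  then show ?thesis by (simp add: norm_minus_commute)
qed

section \<open>Proximal maps of proper closed convex functions\<close>

lemma proper_closed_convex_segment:
  assumes "proper_closed_convex \<psi>" "\<psi> u \<le> ereal a" "\<psi> v \<le> ereal b" "0 \<le> t" "t \<le> 1"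
  shows "\<psi> (u + t *\<^sub>R (v - u)) \<le> ereal ((1 - t) * a + t * b)"
proof -
  let ?E = "{(x, r :: real). \<psi> x \<le> ereal r}"
  have "convex ?E" using assms(1) by (simp add: proper_closed_convex_def)
  from convexD[OF this, of "(u, a)" "(v, b)" "1 - t" t] assms(2-)
  have "(1 - t) *\<^sub>R (u, a) + t *\<^sub>R (v, b) \<in> ?E" by simp
  then show ?thesis by (simp add: algebra_simps)
qed

text \<open>First-order optimality: perturb the minimizer towards \<open>u\<close> by \<open>t\<close>, divide by \<open>t\<close>, let \<open>t \<rightarrow> 0\<close>.\<close>

lemma minimizer_subgradient:
  fixes q :: "'a::euclidean_space \<Rightarrow> real"
  assumes psi: "proper_closed_convex \<psi>" and "\<psi> x = ereal a" "\<psi> u = ereal b"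
    and min: "\<And>v c. \<psi> v = ereal c \<Longrightarrow> q x + a \<le> q v + c"
    and smooth: "\<And>v. q v \<le> q x + inner g (v - x) + c / 2 * (norm (v - x))\<^sup>2"
  shows "a - inner g (u - x) \<le> b"
proof (rule ccontr)
  define K where "K = \<bar>c\<bar> / 2 * (norm (u - x))\<^sup>2 + 1"
  define D where "D = a - inner g (u - x) - b"
  assume "\<not> ?thesis"
  then have D: "D > 0" by (simp add: D_def)
  have K: "K \<ge> 1" by (simp add: K_def)
  have *: "D \<le> t * (c / 2 * (norm (u - x))\<^sup>2)" if t: "0 < t" "t \<le> 1" for t
  proof -
    let ?v = "x + t *\<^sub>R (u - x)"
    have le: "\<psi> ?v \<le> ereal ((1 - t) * a + t * b)"
      using proper_closed_convex_segment[OF psi] assms(2,3) t by simp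
    moreover have "\<psi> ?v \<noteq> -\<infinity>" using psi by (simp add: proper_closed_convex_def)
    ultimately obtain r where r: "\<psi> ?v = ereal r" by (cases "\<psi> ?v") auto
    with le have "r \<le> (1 - t) * a + t * b" by simp
    moreover have "q x + a \<le> q ?v + r" by (rule min[OF r])
    moreover have "q ?v \<le> q x + t * inner g (u - x) + c / 2 * (t\<^sup>2 * (norm (u - x))\<^sup>2)"
      using smooth[of ?v] by (simp add: power_mult_distrib)
    ultimately have "t * D \<le> t * (t * (c / 2 * (norm (u - x))\<^sup>2))"
      by (simp add: D_def algebra_simps power2_eq_square)
    then show ?thesis using t by simp
  qed
  \<comment> \<open>In place of a limit, one explicit \<open>t\<close> for which the quadratic term
    is at most \<open>D / 2\<close>; the summand 1 in \<open>K\<close> keeps the denominator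
    positive.\<close>
  define t where "t = min 1 (D / (2 * K))"
  have t: "0 < t" "t \<le> 1" "t \<le> D / (2 * K)" using D K by (auto simp: t_def)
  have "D \<le> t * (c / 2 * (norm (u - x))\<^sup>2)" by (rule *[OF t(1,2)])
  also have "\<dots> \<le> t * K"
    using t by (intro mult_left_mono) (auto simp: K_def intro!: mult_right_mono add_increasing2)
  also have "\<dots> \<le> D / (2 * K) * K" using t K by (intro mult_right_mono) auto
  also have "\<dots> = D / 2" using K by simp
  finally show False using D by simp
qed

text \<open>The affine minorant makes the objective coercive. Since \<open>\<psi>\<close> has only a
  closed epigraph and need not be continuous, the minimum is sought over pairs \<open>(u, r)\<close>
  in the epigraph: there the objective is continuous and its sublevel set \<open>K\<close> is
  compact.\<close>

lemma prox_minimizer: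
  fixes \<psi> :: "'a::euclidean_space \<Rightarrow> ereal"
  assumes psi: "proper_closed_convex \<psi>" and eta: "\<eta> > 0"
    and x: "\<psi> x = ereal a" and minorant: "\<And>u b. \<psi> u = ereal b \<Longrightarrow> a - inner g (u - x) \<le> b"
  obtains c where "\<psi> (prox \<eta> \<psi> v) = ereal c"
    and "\<And>u b. \<psi> u = ereal b \<Longrightarrow>
       (norm (prox \<eta> \<psi> v - v))\<^sup>2 / 2 + \<eta> * c \<le> (norm (u - v))\<^sup>2 / 2 + \<eta> * b"
proof -
  let ?F = "\<lambda>u. ereal ((norm (u - v))\<^sup>2 / 2) + ereal \<eta> * \<psi> u"
  let ?q = "\<lambda>(u, r :: real). (norm (u - v))\<^sup>2 / 2 + \<eta> * r"
  define m where "m = ?q (x, a)"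
  define K where "K = {(u, r :: real). \<psi> u \<le> ereal r} \<inter> {z. ?q z \<le> m}"
  have ninf: "\<psi> u \<noteq> -\<infinity>" for u using psi by (simp add: proper_closed_convex_def)
  have cont: "continuous_on UNIV ?q"
    unfolding case_prod_beta' by (intro continuous_intros) auto
  have "closed K" unfolding K_def
    using psi closed_Collect_le[OF cont continuous_on_const, of m]
    by (intro closed_Int) (auto simp: proper_closed_convex_def)
  moreover have "bounded K"
  proof -
    define g1 where "g1 = norm g"
    define A where "A = \<bar>m\<bar> + \<eta> * \<bar>a\<bar> + \<eta> * g1 * norm (v - x)"
    \<comment> \<open>Chosen so that the quadratic estimate \<open>quad\<close> fails as soon as
      \<open>norm (u - v)\<close> exceeds \<open>R\<close>.\<close>
    define R where "R = 2 * \<eta> * g1 + 2 * A + 1"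
    have nn: "g1 \<ge> 0" "A \<ge> 0" using eta by (auto simp: A_def g1_def)
    have "norm (u - v) \<le> R \<and> \<bar>r\<bar> \<le> \<bar>m\<bar> / \<eta> + \<bar>a\<bar> + g1 * (norm (v - x) + R)" if "(u, r) \<in> K" for u r
    proof -
      from that have ur: "\<psi> u \<le> ereal r" and q: "(norm (u - v))\<^sup>2 / 2 + \<eta> * r \<le> m"
        by (auto simp: K_def)
      obtain b where b: "\<psi> u = ereal b" using ur ninf[of u] by (cases "\<psi> u") auto
      have "inner g (u - x) \<le> g1 * norm (u - x)" unfolding g1_def by (rule norm_cauchy_schwarz)
      also have "\<dots> \<le> g1 * (norm (u - v) + norm (v - x))"
        using norm_triangle_ineq[of "u - v" "v - x"] nn by (intro mult_left_mono) auto
      finally have lb: "a - g1 * (norm (u - v) + norm (v - x)) \<le> r"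
        using minorant[OF b] ur b by simp
      have "\<eta> * (a - g1 * (norm (u - v) + norm (v - x))) \<le> \<eta> * r"
        using lb eta by (intro mult_left_mono) auto
      moreover have "\<eta> * a \<ge> - (\<eta> * \<bar>a\<bar>)" using eta
        by (metis abs_ge_minus_self abs_mult abs_of_pos minus_le_iff)
      ultimately have quad: "(norm (u - v))\<^sup>2 / 2 \<le> A + \<eta> * g1 * norm (u - v)"
        using q by (simp add: A_def algebra_simps)
      have nR: "norm (u - v) \<le> R"
      proof (rule ccontr)
        assume "\<not> ?thesis"
        then have gt: "norm (u - v) > R" by simp
        have R1: "R \<ge> 1" using nn eta by (simp add: R_def)
        have "A \<le> A * norm (u - v)" using gt R1 nn mult_left_mono[of 1 "norm (u - v)" A] by simp
        with quad have "(norm (u - v))\<^sup>2 \<le> (2 * A + 2 * \<eta> * g1) * norm (u - v)"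
          by (simp add: algebra_simps)
        then have "norm (u - v) \<le> 2 * A + 2 * \<eta> * g1"
          unfolding power2_eq_square by (rule mult_right_le_imp_le) (use gt R1 in linarith)
        then show False using gt by (simp add: R_def)
      qed
      have "\<eta> * r \<le> \<bar>m\<bar>" using q zero_le_power2[of "norm (u - v)"] by linarith
      then have "r \<le> \<bar>m\<bar> / \<eta>" using eta by (simp add: field_simps)
      moreover have "g1 * (norm (u - v) + norm (v - x)) \<le> g1 * (norm (v - x) + R)"
        using nR nn by (intro mult_left_mono) auto
      moreover have "0 \<le> g1 * (norm (v - x) + R)" "0 \<le> \<bar>m\<bar> / \<eta>" using nn eta nR norm_ge_zero[of "u - v"]
        by (auto intro!: mult_nonneg_nonneg add_nonneg_nonneg order_trans[OF norm_ge_zero nR])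
      ultimately have "\<bar>r\<bar> \<le> \<bar>m\<bar> / \<eta> + \<bar>a\<bar> + g1 * (norm (v - x) + R)"
        using lb by (auto simp: abs_if split: if_splits)
      with nR show ?thesis by blast
    qed
    then have "K \<subseteq> cball v R \<times> {- (\<bar>m\<bar> / \<eta> + \<bar>a\<bar> + g1 * (norm (v - x) + R)) .. \<bar>m\<bar> / \<eta> + \<bar>a\<bar> + g1 * (norm (v - x) + R)}"
      by (fastforce simp: dist_norm norm_minus_commute abs_le_iff)
    then show ?thesis by (rule bounded_subset[rotated]) (intro bounded_Times bounded_cball bounded_closed_interval)
  qed
  ultimately have "compact K" by (simp add: compact_eq_bounded_closed)
  moreover have xK: "(x, a) \<in> K" by (simp add: K_def m_def x)
  ultimately obtain z where z: "z \<in> K" "\<And>z'. z' \<in> K \<Longrightarrow> ?q z \<le> ?q z'"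
    using continuous_attains_inf[of K ?q] continuous_on_subset[OF cont] by blast
  have zq: "?q z \<le> ?q z'" if "\<psi> (fst z') \<le> ereal (snd z')" for z'
    using z(2)[OF xK] z(2)[of z'] that by (cases "?q z' \<le> m") (auto simp: K_def m_def case_prod_beta')
  obtain u0 r0 where u0: "z = (u0, r0)" by force
  have F0: "?F u0 \<le> ereal (?q z)"
  proof -
    have "\<psi> u0 \<le> ereal r0" using z(1) by (simp add: K_def u0)
    then have "ereal \<eta> * \<psi> u0 \<le> ereal \<eta> * ereal r0" using eta by (intro ereal_mult_left_mono) auto
    from add_left_mono[OF this, of "ereal ((norm (u0 - v))\<^sup>2 / 2)"] show ?thesis by (simp add: u0)
  qed
  have lb: "ereal (?q z) \<le> ?F u" for u
  proof (cases "\<psi> u")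
    case (real b)
    then show ?thesis using zq[of "(u, b)"] by simp
  next
    case PInf
    then show ?thesis using eta by simp
  qed (use ninf in auto)
  \<comment> \<open>\<open>prox\<close> is defined by choice among minimizers, so exhibiting one
    minimizer transfers minimality to the chosen one.\<close>
  have "is_arg_min ?F (\<lambda>_. True) u0"
    unfolding is_arg_min_linorder using order_trans[OF F0 lb] by simp
  then have "is_arg_min ?F (\<lambda>_. True) (prox \<eta> \<psi> v)"
    unfolding prox_def arg_min_def by (rule someI)
  then have m: "?F (prox \<eta> \<psi> v) \<le> ?F u" for u by (simp add: is_arg_min_linorder)
  have "?F (prox \<eta> \<psi> v) \<le> ?F x" by (rule m)
  then have "\<psi> (prox \<eta> \<psi> v) \<noteq> \<infinity>" using eta x by auto
  then obtain c where c: "\<psi> (prox \<eta> \<psi> v) = ereal c" using ninf[of "prox \<eta> \<psi> v"] by (cases "\<psi> (prox \<eta> \<psi> v)") auto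
  show ?thesis
  proof (rule that[OF c])
    fix u b assume "\<psi> u = ereal b"
    with m[of u] c show "(norm (prox \<eta> \<psi> v - v))\<^sup>2 / 2 + \<eta> * c \<le> (norm (u - v))\<^sup>2 / 2 + \<eta> * b"
      by simp
  qed
qed

text \<open>First-order optimality with \<open>q\<close> the scaled squared distance to
  \<open>v\<close>: its second-order expansion is exact with \<open>c = 1 / \<eta>\<close>, so
  \<open>(v - prox \<eta> \<psi> v) / \<eta>\<close> is a subgradient of \<open>\<psi>\<close> at
  the proximal point.\<close>

lemma prox_variational:
  fixes \<psi> :: "'a::euclidean_space \<Rightarrow> ereal"
  assumes psi: "proper_closed_convex \<psi>" and eta: "\<eta> > 0"
    and x: "\<psi> x = ereal a" and minorant: "\<And>u b. \<psi> u = ereal b \<Longrightarrow> a - inner g (u - x) \<le> b"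
  obtains c where "\<psi> (prox \<eta> \<psi> v) = ereal c"
    and "\<And>u b. \<psi> u = ereal b \<Longrightarrow> c + inner ((1 / \<eta>) *\<^sub>R (v - prox \<eta> \<psi> v)) (u - prox \<eta> \<psi> v) \<le> b"
proof -
  let ?y = "prox \<eta> \<psi> v"
  let ?q = "\<lambda>u. (norm (u - v))\<^sup>2 / (2 * \<eta>)"
  obtain c where c: "\<psi> ?y = ereal c" and m: "\<And>u b. \<psi> u = ereal b \<Longrightarrow>
       (norm (?y - v))\<^sup>2 / 2 + \<eta> * c \<le> (norm (u - v))\<^sup>2 / 2 + \<eta> * b"
    using prox_minimizer[OF assms] by blast
  have *: "c - inner ((1 / \<eta>) *\<^sub>R (?y - v)) (u - ?y) \<le> b" if "\<psi> u = ereal b" for u b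
  proof (rule minimizer_subgradient[OF psi c that, where q = ?q and c = "1 / \<eta>"])
    fix u d assume "\<psi> u = ereal d"
    from divide_right_mono[OF m[OF this], of \<eta>] show "?q ?y + c \<le> ?q u + d"
      using eta by (simp add: add_divide_distrib)
  next
    fix u
    have "(norm (u - v))\<^sup>2 = (norm (?y - v))\<^sup>2 + 2 * inner (?y - v) (u - ?y) + (norm (u - ?y))\<^sup>2"
      unfolding power2_norm_eq_inner by (simp add: algebra_simps inner_commute)
    moreover have "inner ((1 / \<eta>) *\<^sub>R (?y - v)) (u - ?y) = inner (?y - v) (u - ?y) / \<eta>"
      by (simp only: inner_scaleR_left) simp
    ultimately show "?q u \<le> ?q ?y + inner ((1 / \<eta>) *\<^sub>R (?y - v)) (u - ?y) + 1 / \<eta> / 2 * (norm (u - ?y))\<^sup>2"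
      using eta by (simp add: field_simps)
  qed
  have "c + inner ((1 / \<eta>) *\<^sub>R (v - ?y)) (u - ?y) \<le> b" if "\<psi> u = ereal b" for u b
  proof -
    have "(1 / \<eta>) *\<^sub>R (v - ?y) = - ((1 / \<eta>) *\<^sub>R (?y - v))" by (simp add: scaleR_diff_right)
    with *[OF that] show ?thesis by (simp only: inner_minus_left)
  qed
  with c show ?thesis by (rule that)
qed

text \<open>Each of the two subgradient inequalities is tested at the other proximal point; their
  sum and Cauchy-Schwarz give the bound. It yields continuity, and thereby measurability, of the
  proximal map.\<close>

lemma prox_nonexpansive:
  fixes \<psi> :: "'a::euclidean_space \<Rightarrow> ereal"
  assumes psi: "proper_closed_convex \<psi>" and eta: "\<eta> > 0"
    and x: "\<psi> x = ereal a" and minorant: "\<And>u b. \<psi> u = ereal b \<Longrightarrow> a - inner g (u - x) \<le> b"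
  shows "norm (prox \<eta> \<psi> u - prox \<eta> \<psi> v) \<le> norm (u - v)"
proof -
  let ?y = "prox \<eta> \<psi> u" and ?z = "prox \<eta> \<psi> v"
  obtain c where c: "\<psi> ?y = ereal c" and
    cm: "\<And>t b. \<psi> t = ereal b \<Longrightarrow> c + inner ((1 / \<eta>) *\<^sub>R (u - ?y)) (t - ?y) \<le> b"
    using prox_variational[OF assms] by blast
  obtain d where d: "\<psi> ?z = ereal d" and
    dm: "\<And>t b. \<psi> t = ereal b \<Longrightarrow> d + inner ((1 / \<eta>) *\<^sub>R (v - ?z)) (t - ?z) \<le> b"
    using prox_variational[OF assms] by blast
  have "inner ((1 / \<eta>) *\<^sub>R (u - ?y)) (?z - ?y) + inner ((1 / \<eta>) *\<^sub>R (v - ?z)) (?y - ?z) \<le> 0"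
    using cm[OF d] dm[OF c] by linarith
  then have "(1 / \<eta>) * (inner (u - ?y) (?z - ?y) + inner (v - ?z) (?y - ?z)) \<le> 0"
    by (simp add: algebra_simps)
  then have "inner (u - ?y) (?z - ?y) + inner (v - ?z) (?y - ?z) \<le> 0"
    using eta by (simp only: mult_le_0_iff) auto
  then have "(norm (?y - ?z))\<^sup>2 \<le> inner (u - v) (?y - ?z)"
    unfolding power2_norm_eq_inner by (simp add: algebra_simps inner_commute)
  also have "\<dots> \<le> norm (u - v) * norm (?y - ?z)" by (rule norm_cauchy_schwarz)
  finally show ?thesis
    by (cases "norm (?y - ?z) = 0") (auto simp: power2_eq_square)
qed

section \<open>Pointwise descent\<close>

text \<open>Right side minus left side equals \<open>(1 - \<beta>) / \<beta>\<close> times the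
  squared norm of \<open>\<beta> *\<^sub>R (Z - X) - \<gamma> *\<^sub>R G\<close>. It is applied
  with \<open>Z = z - xstar\<close> and \<open>X = x - xstar\<close>.\<close>

lemma three_point_inequality:
  fixes G Z X :: "'a::real_inner"
  assumes "0 < \<beta>" "\<beta> \<le> 1"
  shows "2 * \<gamma> * inner G Z \<le> (1 - \<beta>) * (norm X)\<^sup>2 + \<beta> * (norm Z)\<^sup>2
     - (norm (\<beta> *\<^sub>R Z + (1 - \<beta>) *\<^sub>R X - \<gamma> *\<^sub>R G))\<^sup>2 + \<gamma>\<^sup>2 / \<beta> * (norm G)\<^sup>2"
proof -
  have "0 \<le> (1 - \<beta>) / \<beta> * (norm (\<beta> *\<^sub>R (Z - X) - \<gamma> *\<^sub>R G))\<^sup>2" using assms by simp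
  also have "\<dots> = (1 - \<beta>) * (norm X)\<^sup>2 + \<beta> * (norm Z)\<^sup>2
     - (norm (\<beta> *\<^sub>R Z + (1 - \<beta>) *\<^sub>R X - \<gamma> *\<^sub>R G))\<^sup>2 + \<gamma>\<^sup>2 / \<beta> * (norm G)\<^sup>2 - 2 * \<gamma> * inner G Z"
  proof -
    have "(1 - \<beta>) / \<beta> * (norm (\<beta> *\<^sub>R (Z - X) - \<gamma> *\<^sub>R G))\<^sup>2
      = (1 - \<beta>) * \<beta> * inner (Z - X) (Z - X) - 2 * (1 - \<beta>) * \<gamma> * inner (Z - X) G + (\<gamma>\<^sup>2 / \<beta> - \<gamma>\<^sup>2) * inner G G"
      unfolding power2_norm_eq_inner inner_diff_left inner_diff_right inner_scaleR_left inner_scaleR_right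
      using assms by (simp add: field_simps power2_eq_square inner_commute)
    then show ?thesis
      unfolding power2_norm_eq_inner
      by (simp add: algebra_simps inner_commute power2_eq_square)
  qed
  finally show ?thesis by simp
qed

lemma inner_le_weighted_squares:
  fixes a b :: "'a::real_inner"
  assumes "c > 0"
  shows "inner a b \<le> c * (norm a)\<^sup>2 + 1 / (4 * c) * (norm b)\<^sup>2"
proof -
  have "0 \<le> (norm ((2 * c) *\<^sub>R a - b))\<^sup>2" by simp
  also have "\<dots> = 4 * c * (c * (norm a)\<^sup>2 + 1 / (4 * c) * (norm b)\<^sup>2 - inner a b)"
    unfolding power2_norm_eq_inner using assms by (simp add: algebra_simps inner_commute)
  finally show ?thesis using assms by (simp add: zero_le_mult_iff)
qed

lemma norm_add_square_le:
  fixes a b :: "'a::real_inner"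
  assumes "c > 0"
  shows "(norm (a + b))\<^sup>2 \<le> (1 + c) * (norm a)\<^sup>2 + (1 + 1 / c) * (norm b)\<^sup>2"
proof -
  have "(norm (a + b))\<^sup>2 = (norm a)\<^sup>2 + 2 * inner a b + (norm b)\<^sup>2"
    unfolding power2_norm_eq_inner by (simp add: algebra_simps inner_commute)
  moreover have "inner a b \<le> c / 2 * (norm a)\<^sup>2 + 1 / (2 * c) * (norm b)\<^sup>2"
    using inner_le_weighted_squares[of "c / 2" a b] assms by simp
  ultimately show ?thesis by (simp add: algebra_simps)
qed

section \<open>The composite objective: Bregman distances, gradient differences and
  optimality\<close>

locale adiana_problem =
  fixes f :: "nat \<Rightarrow> 'a::euclidean_space \<Rightarrow> real" and gradf :: "nat \<Rightarrow> 'a \<Rightarrow> 'a"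
    and \<psi> :: "'a \<Rightarrow> ereal" and xstar :: 'a and n :: nat and L \<mu> :: real
  assumes n: "n \<ge> 1" and mu: "\<mu> > 0"
    and grad: "\<And>i x. i < n \<Longrightarrow> GDERIV (f i) x :> gradf i x"
    and lipschitz: "\<And>i. i < n \<Longrightarrow> L-lipschitz_on UNIV (gradf i)"
    and convex: "\<And>i. i < n \<Longrightarrow> convex_on UNIV (f i)"
    and strongly: "strongly_convex \<mu> (\<lambda>x. (1 / real n) * (\<Sum>i<n. f i x))
           (\<lambda>x. (1 / real n) *\<^sub>R (\<Sum>i<n. gradf i x))"
    and psi: "proper_closed_convex \<psi>"
    and xstar: "is_arg_min (\<lambda>x. ereal ((1 / real n) * (\<Sum>i<n. f i x)) + \<psi> x) (\<lambda>_. True) xstar"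
begin

definition favg :: "'a \<Rightarrow> real" where "favg x = (1 / real n) * (\<Sum>i<n. f i x)"
definition gavg :: "'a \<Rightarrow> 'a" where "gavg x = (1 / real n) *\<^sub>R (\<Sum>i<n. gradf i x)"
definition breg :: "'a \<Rightarrow> 'a \<Rightarrow> real" where "breg u x = favg u - favg x - inner (gavg x) (u - x)"
text \<open>\<open>real_of_ereal\<close> sends infinity to 0, so this is the objective gap only
  where \<open>\<psi>\<close> is finite; its sign is claimed only there.\<close>

definition gap :: "'a \<Rightarrow> real" where
  "gap u = (favg u + real_of_ereal (\<psi> u)) - (favg xstar + real_of_ereal (\<psi> xstar))"
definition gdiff :: "'a \<Rightarrow> 'a \<Rightarrow> real" where
  "gdiff u x = (1 / real n) * (\<Sum>i<n. (norm (gradf i u - gradf i x))\<^sup>2)"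

lemma psi_ereal: "\<psi> u \<noteq> \<infinity> \<Longrightarrow> \<psi> u = ereal (real_of_ereal (\<psi> u))"
  using psi by (cases "\<psi> u") (auto simp: proper_closed_convex_def)

lemma descent_avg: "favg u \<le> favg x + inner (gavg x) (u - x) + L / 2 * (norm (u - x))\<^sup>2"
proof -
  have "(\<Sum>i<n. f i u) \<le> (\<Sum>i<n. f i x + inner (gradf i x) (u - x) + L / 2 * (norm (u - x))\<^sup>2)"
    by (intro sum_mono lipschitz_gradient_descent grad lipschitz) auto
  also have "\<dots> = (\<Sum>i<n. f i x) + inner (\<Sum>i<n. gradf i x) (u - x) + real n * (L / 2 * (norm (u - x))\<^sup>2)"
    by (simp only: sum.distrib inner_sum_left) simp
  finally have "(1 / real n) * (\<Sum>i<n. f i u) \<le> (1 / real n) * ((\<Sum>i<n. f i x)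
      + inner (\<Sum>i<n. gradf i x) (u - x) + real n * (L / 2 * (norm (u - x))\<^sup>2))"
    by (intro mult_left_mono) auto
  then show ?thesis unfolding favg_def gavg_def using n
    by (simp only: distrib_left inner_scaleR_left) simp
qed

lemma breg_strong: "\<mu> / 2 * (norm (u - x))\<^sup>2 \<le> breg u x"
  using strongly unfolding strongly_convex_def breg_def favg_def gavg_def by blast

text \<open>Along a unit basis vector, the quadratic lower bound of strong convexity lies below the
  quadratic upper bound of the descent lemma. Positivity of \<open>L\<close> follows.\<close>

lemma mu_le_L: "\<mu> \<le> L"
proof -
  obtain b :: 'a where "b \<in> Basis" using nonempty_Basis by blast
  then have "norm b = 1" by simp
  with breg_strong[of b 0] descent_avg[of b 0] show ?thesis by (simp add: breg_def)
qed

lemma L_pos: "L > 0" using mu mu_le_L by simp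

lemma breg_nonneg: "0 \<le> breg u x"
  by (rule order_trans[OF _ breg_strong]) (use mu in simp)

text \<open>Cocoercivity of each \<open>gradf i\<close>, averaged over the machines; this is where
  convexity of the individual losses enters.\<close>

lemma gdiff_le_breg: "gdiff x u \<le> 2 * L * breg u x"
proof -
  have "(\<Sum>i<n. (norm (gradf i x - gradf i u))\<^sup>2) \<le> (\<Sum>i<n. 2 * L * (f i u - f i x - inner (gradf i x) (u - x)))"
    by (intro sum_mono cocoercive_gradient convex grad lipschitz L_pos) auto
  also have "\<dots> = 2 * L * ((\<Sum>i<n. f i u) - (\<Sum>i<n. f i x) - inner (\<Sum>i<n. gradf i x) (u - x))"
    by (simp only: sum_distrib_left[symmetric] sum_subtractf inner_sum_left)
  finally have "(1 / real n) * (\<Sum>i<n. (norm (gradf i x - gradf i u))\<^sup>2)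
      \<le> (1 / real n) * (2 * L * ((\<Sum>i<n. f i u) - (\<Sum>i<n. f i x) - inner (\<Sum>i<n. gradf i x) (u - x)))"
    by (intro mult_left_mono) auto
  also have "\<dots> = 2 * L * ((1 / real n) * (\<Sum>i<n. f i u) - (1 / real n) * (\<Sum>i<n. f i x)
      - (1 / real n) * inner (\<Sum>i<n. gradf i x) (u - x))"
    by (simp only: right_diff_distrib mult_ac)
  finally show ?thesis by (simp only: gdiff_def breg_def favg_def gavg_def inner_scaleR_left)
qed

lemma gdiff_lipschitz: "gdiff x u \<le> L\<^sup>2 * (norm (x - u))\<^sup>2"
proof -
  have "(\<Sum>i<n. (norm (gradf i x - gradf i u))\<^sup>2) \<le> (\<Sum>i<n. (L * norm (x - u))\<^sup>2)"
    using lipschitz_onD[OF lipschitz, of _ x u] by (intro sum_mono power_mono) (auto simp: dist_norm)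
  from mult_left_mono[OF this, of "1 / real n"] n show ?thesis
    by (simp add: gdiff_def power_mult_distrib)
qed

lemma gdiff_commute: "gdiff x u = gdiff u x"
  by (simp add: gdiff_def norm_minus_commute)

lemma gdiff_triangle:
  assumes "c > 0"
  shows "gdiff x v \<le> (1 + c) * gdiff x u + (1 + 1 / c) * gdiff u v"
proof -
  have "(\<Sum>i<n. (norm (gradf i x - gradf i v))\<^sup>2)
      \<le> (\<Sum>i<n. (1 + c) * (norm (gradf i x - gradf i u))\<^sup>2 + (1 + 1 / c) * (norm (gradf i u - gradf i v))\<^sup>2)"
    using norm_add_square_le[OF assms, of "gradf i x - gradf i u" "gradf i u - gradf i v" for i]
    by (intro sum_mono) auto
  also have "\<dots> = (1 + c) * (\<Sum>i<n. (norm (gradf i x - gradf i u))\<^sup>2)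
      + (1 + 1 / c) * (\<Sum>i<n. (norm (gradf i u - gradf i v))\<^sup>2)"
    by (simp add: sum.distrib sum_distrib_left)
  finally show ?thesis using mult_left_mono[of _ _ "1 / real n"]
    by (auto simp: gdiff_def algebra_simps divide_right_mono simp flip: add_divide_distrib)
qed

text \<open>The descent estimate offers the Bregman distance of the reference point
  \<open>r\<close>, not of \<open>w\<close>, so the detour through \<open>r\<close> is paid for by
  the squared distance of \<open>w\<close> and \<open>r\<close>. The Young weight 1/4 keeps the
  Bregman coefficient small enough for \<open>coefficient_breg\<close>.\<close>

lemma gdiff_reference: "gdiff x w \<le> 5 / 2 * L * breg r x + 5 * L\<^sup>2 * (norm (w - r))\<^sup>2"
proof -
  have "gdiff x w \<le> 5 / 4 * gdiff x r + 5 * gdiff r w"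
    using gdiff_triangle[of "1 / 4" x w r] by simp
  then show ?thesis
    using gdiff_le_breg[of x r] gdiff_lipschitz[of r w] by (simp add: norm_minus_commute)
qed

lemma psi_xstar: "\<psi> xstar \<noteq> \<infinity>"
proof
  assume inf: "\<psi> xstar = \<infinity>"
  obtain u where u: "\<psi> u \<noteq> \<infinity>" using psi by (auto simp: proper_closed_convex_def)
  have "ereal (favg xstar) + \<psi> xstar \<le> ereal (favg u) + \<psi> u"
    using xstar by (simp add: is_arg_min_linorder favg_def)
  with inf psi_ereal[OF u] show False by (cases "\<psi> u") auto
qed

lemma xstar_min: "\<psi> u = ereal b \<Longrightarrow> favg xstar + real_of_ereal (\<psi> xstar) \<le> favg u + b"
proof -
  assume u: "\<psi> u = ereal b"
  have "ereal (favg xstar) + \<psi> xstar \<le> ereal (favg u) + \<psi> u"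
    using xstar by (simp add: is_arg_min_linorder favg_def)
  with u psi_ereal[OF psi_xstar] show ?thesis by (metis ereal_less_eq(3) plus_ereal.simps(1))
qed

lemma gap_nonneg: "\<psi> u \<noteq> \<infinity> \<Longrightarrow> 0 \<le> gap u"
  using xstar_min[OF psi_ereal] by (simp add: gap_def)

text \<open>First-order optimality at \<open>xstar\<close>: \<open>- gavg xstar\<close> is a
  subgradient of \<open>\<psi>\<close> there. This is the affine minorant that the results on
  \<open>prox\<close> require.\<close>

lemma psi_minorant:
  "\<psi> u = ereal b \<Longrightarrow> real_of_ereal (\<psi> xstar) - inner (gavg xstar) (u - xstar) \<le> b"
  by (rule minimizer_subgradient[OF psi psi_ereal[OF psi_xstar], where q = favg and c = L])
    (assumption | erule xstar_min | rule descent_avg)+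

context
  fixes \<eta> :: real assumes eta: "\<eta> > 0"
begin

lemma prox_dom: "\<psi> (prox \<eta> \<psi> v) \<noteq> \<infinity>"
  using prox_variational[OF psi eta psi_ereal[OF psi_xstar] psi_minorant] by (metis PInfty_neq_ereal(1))

lemma prox_subgradient:
  assumes "\<psi> u \<noteq> \<infinity>"
  shows "real_of_ereal (\<psi> (prox \<eta> \<psi> v)) + inner ((1 / \<eta>) *\<^sub>R (v - prox \<eta> \<psi> v)) (u - prox \<eta> \<psi> v)
       \<le> real_of_ereal (\<psi> u)"
  by (rule prox_variational[OF psi eta psi_ereal[OF psi_xstar] psi_minorant, of v])
    (use psi_ereal[OF assms] in fastforce)+

lemma prox_continuous: "continuous_on UNIV (prox \<eta> \<psi>)"
proof -
  have "1-lipschitz_on UNIV (prox \<eta> \<psi>)"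
    by (rule lipschitz_onI)
      (auto simp: dist_norm intro: prox_nonexpansive[OF psi eta psi_ereal[OF psi_xstar] psi_minorant])
  then show ?thesis by (rule lipschitz_on_continuous_on)
qed

end

end

text \<open>Of the choices of \<open>\<eta>\<close>, \<open>\<theta>\<close> and \<open>p\<close>,
  the Lyapunov analysis uses just these inequalities; the explicit formulas return in the complexity
  estimate. Here \<open>\<theta>\<close> is \<open>\<theta>\<^sub>1\<close>, and the value 1/2 of
  \<open>\<theta>\<^sub>2\<close> is substituted throughout.\<close>

locale adiana_params = adiana_problem f gradf \<psi> xstar n L \<mu>
  for f :: "nat \<Rightarrow> 'a::euclidean_space \<Rightarrow> real" and gradf \<psi> xstar n L \<mu> +
  fixes \<omega> \<eta> \<theta> p \<gamma> :: real
  assumes omega: "\<omega> \<ge> 0" and eta: "\<eta> > 0" and eta_L: "\<eta> * L \<le> 1 / 2"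
    and eta_omega: "64 * \<omega> * (2 * p * (\<omega> + 1) + 1)\<^sup>2 * (\<eta> * L) \<le> real n"
    and theta: "0 < \<theta>" "\<theta> \<le> 1 / 4" and theta_le: "p * \<theta>\<^sup>2 \<le> \<eta> * \<mu>" and p: "0 < p" "p \<le> 1"
    and gamma: "\<gamma> = \<eta> / (2 * (\<theta> + \<eta> * \<mu>))"
begin

lemma gamma_pos: "\<gamma> > 0" using gamma eta theta mu by (simp add: add_pos_pos)

lemma gamma_mu: "0 < \<gamma> * \<mu>" "\<gamma> * \<mu> < 1 / 2"
proof -
  show "0 < \<gamma> * \<mu>" using gamma_pos mu by simp
  have "0 < \<theta> + \<eta> * \<mu>" using eta theta mu by (simp add: add_pos_pos)
  then show "\<gamma> * \<mu> < 1 / 2" using theta by (simp add: gamma field_simps)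
qed

text \<open>The weight that turns \<open>2 * \<gamma> * inner G Z\<close> in the three-point
  inequality into \<open>\<theta> * inner G Z\<close>.\<close>

definition cZ :: real where "cZ = \<theta> / (2 * \<gamma>)"

lemma cZ_pos: "cZ > 0" using gamma_pos theta by (simp add: cZ_def)

lemma z_step:
  fixes G :: 'a
  assumes z': "z' = (1 - \<gamma> * \<mu>) *\<^sub>R z + (\<gamma> * \<mu>) *\<^sub>R x - \<gamma> *\<^sub>R G"
  shows "\<theta> * inner G (z - xstar) \<le> \<theta> * \<mu> / 2 * (norm (x - xstar))\<^sup>2
     + cZ * (1 - \<gamma> * \<mu>) * (norm (z - xstar))\<^sup>2 - cZ * (norm (z' - xstar))\<^sup>2 + \<eta> / 4 * (norm G)\<^sup>2"
proof -
  define b where "b = 1 - \<gamma> * \<mu>"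
  have b: "0 < b" "b \<le> 1" using gamma_mu by (auto simp: b_def)
  have eq: "z' - xstar = b *\<^sub>R (z - xstar) + (1 - b) *\<^sub>R (x - xstar) - \<gamma> *\<^sub>R G"
    by (simp add: z' b_def algebra_simps)
  have "cZ * (2 * \<gamma> * inner G (z - xstar)) \<le> cZ * ((1 - b) * (norm (x - xstar))\<^sup>2 + b * (norm (z - xstar))\<^sup>2
     - (norm (z' - xstar))\<^sup>2 + \<gamma>\<^sup>2 / b * (norm G)\<^sup>2)"
    unfolding eq using three_point_inequality[OF b] cZ_pos by (intro mult_left_mono) auto
  also have "\<dots> = cZ * (1 - b) * (norm (x - xstar))\<^sup>2 + cZ * b * (norm (z - xstar))\<^sup>2
     - cZ * (norm (z' - xstar))\<^sup>2 + cZ * (\<gamma>\<^sup>2 / b) * (norm G)\<^sup>2"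
    by (simp add: algebra_simps)
  also have "cZ * (1 - b) = \<theta> * \<mu> / 2" using gamma_pos by (simp add: cZ_def b_def)
  also have "cZ * (2 * \<gamma> * inner G (z - xstar)) = \<theta> * inner G (z - xstar)"
    using gamma_pos by (simp add: cZ_def)
  finally have "\<theta> * inner G (z - xstar) \<le> \<theta> * \<mu> / 2 * (norm (x - xstar))\<^sup>2 + cZ * b * (norm (z - xstar))\<^sup>2
     - cZ * (norm (z' - xstar))\<^sup>2 + cZ * (\<gamma>\<^sup>2 / b) * (norm G)\<^sup>2" .
  \<comment> \<open>The left side equals
    \<open>\<theta> * \<eta> / (2 * (2 * \<theta> + \<eta> * \<mu>))\<close>, so dropping
    \<open>\<eta> * \<mu>\<close> gives the bound.\<close>
  moreover have "cZ * (\<gamma>\<^sup>2 / b) \<le> \<eta> / 4"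
  proof -
    have pos: "0 < 2 * (\<theta> + \<eta> * \<mu>)" using eta theta mu by (simp add: add_pos_pos)
    have "b = (2 * \<theta> + \<eta> * \<mu>) / (2 * (\<theta> + \<eta> * \<mu>))"
      using pos by (simp add: b_def gamma field_simps)
    then have "\<gamma> / b = \<eta> / (2 * \<theta> + \<eta> * \<mu>)" using pos by (simp add: gamma)
    moreover have "cZ * (\<gamma>\<^sup>2 / b) = \<theta> / 2 * (\<gamma> / b)"
      using gamma_pos by (simp only: cZ_def power2_eq_square) simp
    moreover have "0 < 2 * \<theta> + \<eta> * \<mu>" using eta theta mu by (simp add: add_pos_pos)
    ultimately show ?thesis using eta mu theta by (simp only:) (simp add: field_simps)
  qed
  then have "cZ * (\<gamma>\<^sup>2 / b) * (norm G)\<^sup>2 \<le> \<eta> / 4 * (norm G)\<^sup>2" by (intro mult_right_mono) auto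
  ultimately show ?thesis unfolding b_def by linarith
qed

text \<open>\<open>ub\<close> is the combination defining \<open>x\<close> with \<open>z\<close>,
  \<open>w\<close>, \<open>y\<close> replaced by \<open>xstar\<close>, \<open>r\<close>,
  \<open>s\<close>, and \<open>e\<close> is the error of the gradient estimate. The subgradient
  inequality at \<open>y'\<close> and the expansion of \<open>favg\<close> at \<open>x\<close> are
  averaged over these three points with weights \<open>\<theta>\<close>, 1/2 and
  \<open>1/2 - \<theta>\<close>.\<close>

lemma pointwise_descent:
  fixes e :: 'a
  assumes x: "x = \<theta> *\<^sub>R z + (1 / 2) *\<^sub>R w + (1 / 2 - \<theta>) *\<^sub>R y"
    and y': "y' = prox \<eta> \<psi> (x - \<eta> *\<^sub>R (gavg x + e))"
    and z': "z' = (1 - \<gamma> * \<mu>) *\<^sub>R z + (\<gamma> * \<mu>) *\<^sub>R x + (\<gamma> / \<eta>) *\<^sub>R (y' - x)"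
    and ub: "ub = \<theta> *\<^sub>R xstar + (1 / 2) *\<^sub>R r + (1 / 2 - \<theta>) *\<^sub>R s"
    and r: "\<psi> r \<noteq> \<infinity>" and s: "\<psi> s \<noteq> \<infinity>"
  shows "gap y' + cZ * (norm (z' - xstar))\<^sup>2
     \<le> cZ * (1 - \<gamma> * \<mu>) * (norm (z - xstar))\<^sup>2 + gap r / 2 + (1 / 2 - \<theta>) * gap s
       - breg r x / 2 - (1 / 2 - \<theta>) * breg s x
       + 1 / \<eta> * ((norm (w - r))\<^sup>2 + (norm (y - s))\<^sup>2) + inner e (ub - x) + 3 / 4 * \<eta> * (norm e)\<^sup>2"
proof -
  define G where "G = (1 / \<eta>) *\<^sub>R (x - y')"
  define t where "t = 1 / 2 - \<theta>"
  \<comment> \<open>The part of \<open>x - ub\<close> caused by \<open>w\<close> and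
    \<open>y\<close> differing from their reference points.\<close>
  define d where "d = (1 / 2) *\<^sub>R (w - r) + t *\<^sub>R (y - s)"
  define \<phi> where "\<phi> u = real_of_ereal (\<psi> u)" for u
  have t: "0 \<le> t" "t \<le> 1 / 2" using theta by (auto simp: t_def)
  have split: "v = \<theta> *\<^sub>R v + (1 / 2) *\<^sub>R v + t *\<^sub>R v" for v :: 'a
    by (simp add: t_def flip: scaleR_add_left)
  have ub_minus: "ub - v = \<theta> *\<^sub>R (xstar - v) + (1 / 2) *\<^sub>R (r - v) + t *\<^sub>R (s - v)" for v
    by (subst split[of v]) (simp add: ub t_def[symmetric] scaleR_diff_right)
  have y'G: "y' = x - \<eta> *\<^sub>R G" using eta by (simp add: G_def)
  have sub: "\<phi> y' + inner (G - gavg x - e) (u - y') \<le> \<phi> u" if "\<psi> u \<noteq> \<infinity>" for u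
  proof -
    have "(1 / \<eta>) *\<^sub>R (x - \<eta> *\<^sub>R (gavg x + e) - y') = G - gavg x - e"
      using eta by (simp add: G_def algebra_simps)
    with prox_subgradient[OF eta that, of "x - \<eta> *\<^sub>R (gavg x + e)"] show ?thesis
      by (simp add: \<phi>_def flip: y')
  qed
  have *: "\<theta> * (\<phi> y' + inner (G - gavg x - e) (xstar - y')) \<le> \<theta> * \<phi> xstar"
       "t * (\<phi> y' + inner (G - gavg x - e) (s - y')) \<le> t * \<phi> s"
    using sub[OF psi_xstar] sub[OF s] theta t by (auto intro: mult_left_mono)
  have **: "inner (G - gavg x - e) (ub - y') = \<theta> * inner (G - gavg x - e) (xstar - y')
      + inner (G - gavg x - e) (r - y') / 2 + t * inner (G - gavg x - e) (s - y')"
    by (simp add: ub_minus inner_add_right)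
  have phi: "\<phi> y' + inner (G - gavg x - e) (ub - y') \<le> \<theta> * \<phi> xstar + \<phi> r / 2 + t * \<phi> s"
  proof -
    have "\<phi> y' = \<theta> * \<phi> y' + \<phi> y' / 2 + t * \<phi> y'" by (simp add: t_def algebra_simps)
    with * ** sub[OF r] show ?thesis unfolding distrib_left by linarith
  qed
  have gx: "inner (gavg x) (ub - x) = \<theta> * inner (gavg x) (xstar - x)
      + inner (gavg x) (r - x) / 2 + t * inner (gavg x) (s - x)"
    by (simp add: ub_minus inner_add_right)
  have fb: "favg x + inner (gavg x) (ub - x) = \<theta> * favg xstar + favg r / 2 + t * favg s
      - \<theta> * breg xstar x - breg r x / 2 - t * breg s x"
  proof -
    have "favg x = \<theta> * favg x + favg x / 2 + t * favg x" by (simp add: t_def algebra_simps)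
    with gx show ?thesis unfolding breg_def right_diff_distrib by argo
  qed
  have desc: "favg y' \<le> favg x + inner (gavg x) (y' - x) + L / 2 * (norm (y' - x))\<^sup>2"
    by (rule descent_avg)
  have nG: "L / 2 * (norm (y' - x))\<^sup>2 \<le> \<eta> / 4 * (norm G)\<^sup>2"
  proof -
    have "L / 2 * (norm (y' - x))\<^sup>2 = (\<eta> * L) * (\<eta> / 2 * (norm G)\<^sup>2)"
      by (simp add: y'G power_mult_distrib power2_eq_square)
    also have "\<dots> \<le> 1 / 2 * (\<eta> / 2 * (norm G)\<^sup>2)" using eta eta_L by (intro mult_right_mono) auto
    finally show ?thesis by simp
  qed
  have xub: "x - ub = \<theta> *\<^sub>R (z - xstar) + d"
    by (simp add: x ub d_def t_def algebra_simps)
  have "inner (gavg x) (y' - x) - inner (G - gavg x - e) (ub - y') - inner (gavg x) (ub - x)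
      = inner G (x - ub) - \<eta> * (norm G)\<^sup>2 + inner e (ub - x) + \<eta> * inner e G"
    unfolding y'G power2_norm_eq_inner by (simp add: algebra_simps inner_commute)
  also have "inner G (x - ub) = \<theta> * inner G (z - xstar) + inner G d"
    unfolding xub by (simp add: inner_add_right)
  finally have inn: "inner (gavg x) (y' - x) - inner (G - gavg x - e) (ub - y') - inner (gavg x) (ub - x)
      = \<theta> * inner G (z - xstar) + inner G d - \<eta> * (norm G)\<^sup>2 + inner e (ub - x) + \<eta> * inner e G" .
  \<comment> \<open>The reserve \<open>- 3/4 * \<eta> * (norm G)\<^sup>2\<close> is then spent
    completely: 1/4 on the \<open>z\<close> step, 3/8 on \<open>inner e G\<close> and 1/8 on
    \<open>inner G d\<close>.\<close>
  have main: "gap y' \<le> gap r / 2 + t * gap s - \<theta> * breg xstar x - breg r x / 2 - t * breg s x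
      + \<theta> * inner G (z - xstar) + inner G d - 3 / 4 * \<eta> * (norm G)\<^sup>2 + inner e (ub - x) + \<eta> * inner e G"
  proof -
    have "gap y' + favg xstar + \<phi> xstar = favg y' + \<phi> y'"
      "gap r / 2 = (favg r + \<phi> r - favg xstar - \<phi> xstar) / 2"
      "t * gap s = t * favg s + t * \<phi> s - t * favg xstar - t * \<phi> xstar"
      by (simp_all add: gap_def \<phi>_def algebra_simps)
    moreover have "\<theta> * favg xstar = favg xstar / 2 - t * favg xstar"
      "\<theta> * \<phi> xstar = \<phi> xstar / 2 - t * \<phi> xstar" by (simp_all add: t_def algebra_simps)
    ultimately show ?thesis using phi fb desc nG inn by argo
  qed
  have zs: "\<theta> * inner G (z - xstar) \<le> \<theta> * \<mu> / 2 * (norm (x - xstar))\<^sup>2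
     + cZ * (1 - \<gamma> * \<mu>) * (norm (z - xstar))\<^sup>2 - cZ * (norm (z' - xstar))\<^sup>2 + \<eta> / 4 * (norm G)\<^sup>2"
    by (rule z_step) (use eta in \<open>simp add: z' y'G\<close>)
  \<comment> \<open>Strong convexity cancels the term in \<open>norm (x - xstar)\<close> that the
    \<open>z\<close> step produced.\<close>
  have "\<theta> * (\<mu> / 2 * (norm (x - xstar))\<^sup>2) \<le> \<theta> * breg xstar x"
    using breg_strong[of xstar x] theta by (intro mult_left_mono) (auto simp: norm_minus_commute)
  moreover have "\<eta> * inner e G \<le> 3 / 8 * \<eta> * (norm G)\<^sup>2 + 3 / 4 * \<eta> * (norm e)\<^sup>2"
  proof -
    have "inner e G \<le> 3 / 4 * (norm e)\<^sup>2 + 1 / 3 * (norm G)\<^sup>2"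
      using inner_le_weighted_squares[of "3 / 4" e G] by simp
    also have "\<dots> \<le> 3 / 4 * (norm e)\<^sup>2 + 3 / 8 * (norm G)\<^sup>2"
      by (intro add_left_mono mult_right_mono) auto
    finally have "inner e G \<le> 3 / 4 * (norm e)\<^sup>2 + 3 / 8 * (norm G)\<^sup>2" .
    from mult_left_mono[OF this, of \<eta>] eta show ?thesis by (simp add: algebra_simps)
  qed
  moreover have "inner G d \<le> \<eta> / 8 * (norm G)\<^sup>2 + 1 / \<eta> * ((norm (w - r))\<^sup>2 + (norm (y - s))\<^sup>2)"
  proof -
    have "(norm d)\<^sup>2 \<le> 2 * (norm ((1 / 2) *\<^sub>R (w - r)))\<^sup>2 + 2 * (norm (t *\<^sub>R (y - s)))\<^sup>2"
      using norm_add_square_le[of 1 "(1 / 2) *\<^sub>R (w - r)" "t *\<^sub>R (y - s)"] by (simp add: d_def)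
    also have "\<dots> \<le> 1 / 2 * ((norm (w - r))\<^sup>2 + (norm (y - s))\<^sup>2)"
    proof -
      have "t\<^sup>2 \<le> (1 / 2)\<^sup>2" using t by (intro power_mono) auto
      from mult_right_mono[OF this, of "(norm (y - s))\<^sup>2"] show ?thesis
        by (simp add: power_mult_distrib power_divide)
    qed
    finally have d: "(norm d)\<^sup>2 \<le> 1 / 2 * ((norm (w - r))\<^sup>2 + (norm (y - s))\<^sup>2)" .
    have "inner G d \<le> \<eta> / 8 * (norm G)\<^sup>2 + 2 / \<eta> * (norm d)\<^sup>2"
      using inner_le_weighted_squares[of "\<eta> / 8" G d] eta by simp
    also have "\<dots> \<le> \<eta> / 8 * (norm G)\<^sup>2 + 2 / \<eta> * (1 / 2 * ((norm (w - r))\<^sup>2 + (norm (y - s))\<^sup>2))"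
      using eta d by (intro add_left_mono mult_left_mono) auto
    also have "\<dots> = \<eta> / 8 * (norm G)\<^sup>2 + 1 / \<eta> * ((norm (w - r))\<^sup>2 + (norm (y - s))\<^sup>2)"
      by (simp only: mult.assoc[symmetric]) simp
    finally show ?thesis .
  qed
  ultimately show ?thesis using main zs unfolding t_def by argo
qed

end

section \<open>Moments of compressed vectors\<close>

lemma (in prob_space) compression_moments:
  assumes "compression_operator \<omega> M c"
  shows "integrable M (\<lambda>s. c s x)" and "expectation (\<lambda>s. c s x) = x"
    and "integrable M (\<lambda>s. (norm (c s x - x))\<^sup>2)"
    and "0 \<le> \<omega> \<Longrightarrow> expectation (\<lambda>s. (norm (c s x - x))\<^sup>2) \<le> \<omega> * (norm x)\<^sup>2"
proof -
  show i: "integrable M (\<lambda>s. c s x)" and "expectation (\<lambda>s. c s x) = x"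
    using assms by (auto simp: compression_operator_def)
  have le: "(\<integral>\<^sup>+s. ennreal ((norm (c s x - x))\<^sup>2) \<partial>M) \<le> ennreal (\<omega> * (norm x)\<^sup>2)"
    using assms by (auto simp: compression_operator_def)
  have [measurable]: "(\<lambda>s. c s x) \<in> borel_measurable M" using i by simp
  show i2: "integrable M (\<lambda>s. (norm (c s x - x))\<^sup>2)"
    by (rule integrableI_nonneg) (use le in \<open>auto intro: le_less_trans\<close>)
  assume "0 \<le> \<omega>"
  with le nn_integral_eq_integral[OF i2] show "expectation (\<lambda>s. (norm (c s x - x))\<^sup>2) \<le> \<omega> * (norm x)\<^sup>2"
    by (simp add: ennreal_le_iff)
qed

text \<open>The cross term has mean zero, which leaves the factor
  \<open>a\<^sup>2 * \<omega> + (1 - a)\<^sup>2\<close>. For \<open>a = 1 / (\<omega> + 1)\<close>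
  this is exactly \<open>1 - a\<close>, the contraction of the local shifts.\<close>

lemma (in prob_space) compression_affine_square:
  fixes c :: "'a \<Rightarrow> 'b::euclidean_space \<Rightarrow> 'b"
  assumes c: "compression_operator \<omega> M c" and "0 \<le> \<omega>"
  shows "integrable M (\<lambda>s. (norm ((1 / (\<omega> + 1)) *\<^sub>R c s d - d))\<^sup>2)"
    and "expectation (\<lambda>s. (norm ((1 / (\<omega> + 1)) *\<^sub>R c s d - d))\<^sup>2) \<le> (1 - 1 / (\<omega> + 1)) * (norm d)\<^sup>2"
proof -
  define a where "a = 1 / (\<omega> + 1)"
  note m = compression_moments[OF c, of d]
  have eq: "(norm (a *\<^sub>R c s d - d))\<^sup>2
      = a\<^sup>2 * (norm (c s d - d))\<^sup>2 - 2 * a * (1 - a) * inner (c s d - d) d + (1 - a)\<^sup>2 * (norm d)\<^sup>2" for s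
    unfolding power2_norm_eq_inner by (simp add: algebra_simps inner_commute power2_eq_square)
  have i: "integrable M (\<lambda>s. inner (c s d - d) d)" using m(1) by simp
  have z: "expectation (\<lambda>s. inner (c s d - d) d) = 0"
    using m(1,2) by (simp add: prob_space)
  show "integrable M (\<lambda>s. (norm ((1 / (\<omega> + 1)) *\<^sub>R c s d - d))\<^sup>2)"
    unfolding a_def[symmetric] eq using m(3) i by (intro Bochner_Integration.integrable_add
        Bochner_Integration.integrable_diff integrable_mult_right) auto
  have "expectation (\<lambda>s. (norm (a *\<^sub>R c s d - d))\<^sup>2)
      = a\<^sup>2 * expectation (\<lambda>s. (norm (c s d - d))\<^sup>2) + (1 - a)\<^sup>2 * (norm d)\<^sup>2"
    unfolding eq using m(3) i z prob_space by simp
  also have "\<dots> \<le> a\<^sup>2 * (\<omega> * (norm d)\<^sup>2) + (1 - a)\<^sup>2 * (norm d)\<^sup>2"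
    using m(4) assms by (intro add_right_mono mult_left_mono) auto
  also have "\<dots> = (1 - a) * (norm d)\<^sup>2"
  proof -
    have "a * (\<omega> + 1) = 1" using assms by (simp add: a_def)
    then have "a\<^sup>2 * \<omega> + (1 - a)\<^sup>2 = 1 - a" by algebra
    then show ?thesis by (metis distrib_right mult.assoc)
  qed
  finally show "expectation (\<lambda>s. (norm ((1 / (\<omega> + 1)) *\<^sub>R c s d - d))\<^sup>2) \<le> (1 - 1 / (\<omega> + 1)) * (norm d)\<^sup>2"
    by (simp add: a_def)
qed

text \<open>The product rule for independent real variables, summed over coordinates.\<close>

lemma (in prob_space) indep_inner_expectation:
  fixes X Y :: "'a \<Rightarrow> 'b::euclidean_space"
  assumes ind: "indep_var borel X borel Y" and "integrable M X" "integrable M Y"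
  shows "integrable M (\<lambda>s. inner (X s) (Y s))"
    and "expectation (\<lambda>s. inner (X s) (Y s)) = inner (expectation X) (expectation Y)"
proof -
  have ib: "indep_var borel (\<lambda>s. inner (X s) b) borel (\<lambda>s. inner (Y s) b)" for b
    using indep_var_compose[OF ind, of "\<lambda>v. inner v b" borel "\<lambda>v. inner v b" borel] by (simp add: o_def)
  have int: "integrable M (\<lambda>s. inner (X s) b)" "integrable M (\<lambda>s. inner (Y s) b)" for b
    using assms by simp_all
  show "integrable M (\<lambda>s. inner (X s) (Y s))"
    by (subst euclidean_inner) (intro Bochner_Integration.integrable_sum indep_var_integrable[OF ib int(1) int(2)])
  have "expectation (\<lambda>s. inner (X s) (Y s)) = (\<Sum>b\<in>Basis. expectation (\<lambda>s. inner (X s) b * inner (Y s) b))"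
    by (subst euclidean_inner) (intro Bochner_Integration.integral_sum indep_var_integrable[OF ib int(1) int(2)])
  also have "\<dots> = (\<Sum>b\<in>Basis. inner (expectation X) b * inner (expectation Y) b)"
    using assms by (simp add: indep_var_lebesgue_integral[OF ib int(1) int(2)])
  finally show "expectation (\<lambda>s. inner (X s) (Y s)) = inner (expectation X) (expectation Y)"
    by (simp only: euclidean_inner[symmetric])
qed

text \<open>Independence and zero means make the cross terms vanish. This is the source of the
  factor \<open>1 / n\<close> in the variance of the averaged compression error.\<close>

lemma (in prob_space) centered_sum_square:
  fixes X :: "'i \<Rightarrow> 'a \<Rightarrow> 'b::euclidean_space"
  assumes "finite I"
    and int: "\<And>i. i \<in> I \<Longrightarrow> integrable M (X i)" and zero: "\<And>i. i \<in> I \<Longrightarrow> expectation (X i) = 0"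
    and sq: "\<And>i. i \<in> I \<Longrightarrow> integrable M (\<lambda>s. (norm (X i s))\<^sup>2)"
    and ind: "\<And>i j. i \<in> I \<Longrightarrow> j \<in> I \<Longrightarrow> i \<noteq> j \<Longrightarrow> indep_var borel (X i) borel (X j)"
  shows "integrable M (\<lambda>s. (norm (\<Sum>i\<in>I. X i s))\<^sup>2)"
    and "expectation (\<lambda>s. (norm (\<Sum>i\<in>I. X i s))\<^sup>2) = (\<Sum>i\<in>I. expectation (\<lambda>s. (norm (X i s))\<^sup>2))"
proof -
  have eq: "(norm (\<Sum>i\<in>I. X i s))\<^sup>2 = (\<Sum>i\<in>I. \<Sum>j\<in>I. inner (X i s) (X j s))" for s
    by (simp add: power2_norm_eq_inner inner_sum_left inner_sum_right) (rule sum.swap)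
  have i: "integrable M (\<lambda>s. inner (X i s) (X j s))" if "i \<in> I" "j \<in> I" for i j
    using that sq[of i] indep_inner_expectation(1)[OF ind int int, of i j]
    by (cases "i = j") (auto simp: power2_norm_eq_inner)
  have e: "expectation (\<lambda>s. inner (X i s) (X j s)) = (if i = j then expectation (\<lambda>s. (norm (X i s))\<^sup>2) else 0)"
    if "i \<in> I" "j \<in> I" for i j
    using that indep_inner_expectation(2)[OF ind int int, of i j] zero
    by (auto simp: power2_norm_eq_inner)
  show "integrable M (\<lambda>s. (norm (\<Sum>i\<in>I. X i s))\<^sup>2)"
    unfolding eq by (intro Bochner_Integration.integrable_sum i)
  show "expectation (\<lambda>s. (norm (\<Sum>i\<in>I. X i s))\<^sup>2) = (\<Sum>i\<in>I. expectation (\<lambda>s. (norm (X i s))\<^sup>2))"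
    unfolding eq using \<open>finite I\<close> i e by (simp add: integrable_sum)
qed

section \<open>Balancing the coefficients of the Lyapunov function\<close>

context adiana_params
begin

definition cW :: real where "cW = (1 + \<theta>) / (2 * p)"
text \<open>Young parameter for a refresh of \<open>w\<close>: \<open>p / (q - 1)\<close> equals
  \<open>1 / (2 * (\<omega> + 1))\<close>, so refreshes cost at most half of the shift contraction.
  The bound on \<open>\<eta>\<close> contains the square of this quantity.\<close>

definition q :: real where "q = 2 * p * (\<omega> + 1) + 1"
text \<open>Scaled so that a quarter of the contraction \<open>1 / (\<omega> + 1)\<close>, times
  \<open>cH\<close>, equals the variance coefficient
  \<open>3/2 * \<eta> * \<omega> / n\<close>.\<close>

definition cH :: real where "cH = 6 * \<eta> * \<omega> * (\<omega> + 1) / real n"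
text \<open>Bounds the total cost of the squared distances to the reference points: the summands
  come from the descent estimate, from the compression variance and from moving the shift
  targets.\<close>

definition cE :: real where "cE = 1 / \<eta> + 15 / 2 * \<eta> * \<omega> * L\<^sup>2 / real n + 10 * cH * p * q * L\<^sup>2"
definition cA :: real where "cA = 2 * cE / p"
definition cC :: real where "cC = 6 * cE"
definition rho :: real where "rho = min (2 / 5 * p * \<theta>) (1 / (4 * (\<omega> + 1)))"

lemma rho_bounds: "0 < rho" "rho \<le> \<theta> / 2" "rho \<le> p / 2" "rho \<le> 1 / 2" "rho \<le> 1 / (4 * (\<omega> + 1))"
  "rho * (1 + \<theta>) \<le> p * \<theta>"
proof -
  have le: "rho \<le> 2 / 5 * p * \<theta>" "rho \<le> 1 / (4 * (\<omega> + 1))" by (auto simp: rho_def)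
  have pt: "p * \<theta> \<le> 1 * \<theta>" "p * \<theta> \<le> p * (1 / 4)"
    using p theta by (auto intro: mult_right_mono mult_left_mono)
  show "0 < rho" using p theta omega by (simp add: rho_def)
  then have "rho * (1 + \<theta>) \<le> rho * (5 / 4)" using theta by (intro mult_left_mono) auto
  moreover have "0 \<le> p * \<theta>" using p theta by simp
  ultimately show "rho * (1 + \<theta>) \<le> p * \<theta>" using le by linarith
  show "rho \<le> \<theta> / 2" "rho \<le> p / 2" "rho \<le> 1 / 2" "rho \<le> 1 / (4 * (\<omega> + 1))"
    using le pt p theta by linarith+
qed

lemma cH_nonneg: "0 \<le> cH" using eta omega n by (simp add: cH_def)
lemma q_ge_1: "1 \<le> q" using p omega by (simp add: q_def)
lemma cW_pos: "0 < cW" using p theta by (simp add: cW_def)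

lemma cE_pos: "0 < cE"
proof -
  have "0 \<le> 15 / 2 * \<eta> * \<omega> * L\<^sup>2 / real n" "0 \<le> 10 * cH * p * q * L\<^sup>2"
    using cH_nonneg q_ge_1 p eta omega by auto
  then show ?thesis using eta by (simp add: cE_def add_pos_nonneg)
qed

text \<open>It suffices that \<open>rho \<le> \<gamma> * \<mu>\<close>. From
  \<open>p * \<theta>\<^sup>2 \<le> \<eta> * \<mu>\<close> and
  \<open>p * \<theta> \<le> 1/4\<close>, the product
  \<open>p * \<theta> * (\<theta> + \<eta> * \<mu>)\<close> is at most
  \<open>5/4 * \<eta> * \<mu>\<close>, which accounts for the factor 2/5 in
  \<open>rho\<close>.\<close>

lemma coefficient_Z: "cZ * (1 - \<gamma> * \<mu>) \<le> (1 - rho) * cZ"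
proof -
  have pos: "0 < \<theta> + \<eta> * \<mu>" using eta theta mu by (simp add: add_pos_pos)
  have pt: "p * \<theta> \<le> 1 / 4" using p theta mult_mono[of p 1 \<theta> "1 / 4"] by simp
  have "p * \<theta> * \<theta> + (p * \<theta>) * (\<eta> * \<mu>) \<le> \<eta> * \<mu> + 1 / 4 * (\<eta> * \<mu>)"
    using pt theta_le eta mu by (intro add_mono mult_right_mono) (auto simp: power2_eq_square mult.assoc)
  then have "2 / 5 * (p * \<theta>) * (2 * (\<theta> + \<eta> * \<mu>)) \<le> \<eta> * \<mu>" by (simp add: algebra_simps)
  then have "2 / 5 * (p * \<theta>) \<le> \<gamma> * \<mu>" using pos by (simp add: gamma pos_le_divide_eq)
  then have "rho \<le> \<gamma> * \<mu>" by (simp add: rho_def min_le_iff_disj)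
  from mult_left_mono[OF this, of cZ] cZ_pos show ?thesis by (simp add: algebra_simps)
qed

text \<open>\<open>cW * p = (1 + \<theta>) / 2\<close>, so the left side is
  \<open>1 - \<theta> / 2\<close>.\<close>

lemma coefficient_S: "1 / 2 - \<theta> + cW * p \<le> 1 - rho"
  using rho_bounds(2) p by (simp add: cW_def field_simps)

lemma coefficient_R: "1 / 2 + cW * (1 - p) \<le> (1 - rho) * cW"
proof -
  have "rho * (1 + \<theta>) / (2 * p) \<le> p * \<theta> / (2 * p)"
    using rho_bounds(6) p by (intro divide_right_mono) auto
  then have "cW * rho \<le> \<theta> / 2" using p by (simp add: cW_def mult.commute)
  moreover have "cW * p = (1 + \<theta>) / 2" using p by (simp add: cW_def)
  ultimately show ?thesis by (simp add: algebra_simps)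
qed

text \<open>Of the remaining contraction \<open>1 / (2 * (\<omega> + 1))\<close>, one half pays for
  the compression variance and the other half for \<open>rho\<close>.\<close>

lemma coefficient_H:
  "3 / 2 * \<eta> * \<omega> / real n + cH * (1 - 1 / (\<omega> + 1) / 2) \<le> (1 - rho) * cH"
proof -
  have "cH * rho \<le> cH * (1 / (4 * (\<omega> + 1)))"
    by (rule mult_left_mono[OF rho_bounds(5) cH_nonneg])
  also have "\<dots> = cH * (1 / (\<omega> + 1) / 4)" by simp
  finally have "cH * rho \<le> cH * (1 / (\<omega> + 1) / 4)" .
  moreover have "cH * (1 / (\<omega> + 1) / 4) = 3 / 2 * \<eta> * \<omega> / real n"
  proof -
    have "\<omega> + 1 \<noteq> 0" using omega by simp
    then show ?thesis unfolding cH_def using n by (simp add: divide_simps)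
  qed
  moreover have "(1 - rho) * cH - cH * (1 - 1 / (\<omega> + 1) / 2) = 2 * (cH * (1 / (\<omega> + 1) / 4)) - cH * rho"
  proof -
    have "(1 - rho) * cH - cH * (1 - t / 2) = 2 * (cH * (t / 4)) - cH * rho" for t
      by (simp add: field_simps)
    then show ?thesis .
  qed
  ultimately show ?thesis by linarith
qed

text \<open>With \<open>T = \<omega> * \<eta> * L / n\<close>, the bound on \<open>\<eta>\<close>
  says \<open>T * q\<^sup>2 \<le> 1/64\<close>, while \<open>5 * cH * p * q * L\<close> equals
  \<open>15 * T * (q\<^sup>2 - q)\<close>. The second claim then follows from 15/64 < 1/4 and
  \<open>\<theta> \<le> 1/4\<close>.\<close>

lemma coefficient_breg:
  "15 / 4 * \<eta> * \<omega> * L / real n + 5 * cH * p * q * L \<le> 1 / 2"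
  "5 * cH * p * q * L \<le> 1 / 2 - \<theta>"
proof -
  define T where "T = \<omega> * (\<eta> * L) / real n"
  have T0: "T \<ge> 0" using omega eta L_pos by (simp add: T_def)
  have "64 * q\<^sup>2 * (\<omega> * (\<eta> * L)) / real n \<le> 1"
    using eta_omega n by (simp add: q_def mult_ac)
  then have Tq: "T * q\<^sup>2 \<le> 1 / 64" by (simp add: T_def mult_ac)
  have "q - 1 = 2 * p * (\<omega> + 1)" by (simp add: q_def)
  then have eq: "5 * cH * p * q * L = 15 * T * (q\<^sup>2 - q)"
    by (simp add: cH_def T_def power2_eq_square flip: mult.assoc) (simp add: q_def field_simps)
  have TT: "0 \<le> T * q" "T \<le> T * q" using T0 q_ge_1 mult_left_mono[of 1 q T] by auto
  show "15 / 4 * \<eta> * \<omega> * L / real n + 5 * cH * p * q * L \<le> 1 / 2"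
  proof -
    have "15 / 4 * \<eta> * \<omega> * L / real n = 15 / 4 * T" by (simp add: T_def mult_ac)
    then show ?thesis using eq TT Tq by (simp add: algebra_simps)
  qed
  show "5 * cH * p * q * L \<le> 1 / 2 - \<theta>" using eq TT Tq theta by (simp add: algebra_simps)
qed

text \<open>\<open>cA * p = 2 * cE\<close>: one half covers the cost \<open>cE\<close>, the other
  half covers \<open>rho * cA\<close>.\<close>

lemma coefficient_A: "cE + cA * (1 - p) \<le> (1 - rho) * cA"
proof -
  have "cA * rho \<le> cA * (p / 2)" using rho_bounds(3) cE_pos p by (intro mult_left_mono) (auto simp: cA_def)
  moreover have "cA * p = 2 * cE" using p by (simp add: cA_def)
  ultimately show ?thesis by (simp add: algebra_simps)
qed

text \<open>The new \<open>y\<close> is its own reference point, so its distance term restarts at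
  zero. Hence \<open>cC\<close> only has to absorb \<open>cE + cA * p = 3 * cE\<close>, which is
  \<open>cC / 2\<close>.\<close>

lemma coefficient_C: "cE + cA * p \<le> (1 - rho) * cC"
proof -
  have "cC * rho \<le> cC * (1 / 2)" using rho_bounds(4) cE_pos by (intro mult_left_mono) (auto simp: cC_def)
  moreover have "cA * p = 2 * cE" using p by (simp add: cA_def)
  ultimately show ?thesis by (simp add: cC_def algebra_simps)
qed

text \<open>\<open>E\<close> stands for the expected squared compression error. Gradient differences
  are routed through the reference points; after that each summand is handled by the coefficient
  lemma of its kind.\<close>

lemma lyapunov_bound:
  assumes nn: "0 \<le> Z" "0 \<le> S" "0 \<le> R" "0 \<le> H"
    and e: "E \<le> \<omega> / real n * (2 * H + 2 * gdiff x w)"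
  shows "cZ * (1 - \<gamma> * \<mu>) * Z + R / 2 + (1 / 2 - \<theta>) * S - breg r x / 2 - (1 / 2 - \<theta>) * breg s x
       + 1 / \<eta> * ((norm (w - r))\<^sup>2 + (norm (y - s))\<^sup>2) + 3 / 4 * \<eta> * E
       + cW * (p * S + (1 - p) * R) + cH * ((1 - 1 / (\<omega> + 1) / 2) * H + p * q * gdiff w y)
       + cA * (p * (norm (y - s))\<^sup>2 + (1 - p) * (norm (w - r))\<^sup>2)
     \<le> (1 - rho) * (cZ * Z + S + cW * R + cH * H + cA * (norm (w - r))\<^sup>2 + cC * (norm (y - s))\<^sup>2)"
proof -
  define A where "A = (norm (w - r))\<^sup>2"
  define B where "B = (norm (y - s))\<^sup>2"
  define Dr where "Dr = breg r x"
  define Ds where "Ds = breg s x"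
  define k where "k = \<eta> * \<omega> / real n"
  define m where "m = cH * p * q"
  have k: "0 \<le> k" using eta omega by (simp add: k_def)
  have m: "0 \<le> m" using cH_nonneg p q_ge_1 by (simp add: m_def)
  have AB: "0 \<le> A" "0 \<le> B" "0 \<le> Dr" "0 \<le> Ds" by (auto simp: A_def B_def Dr_def Ds_def breg_nonneg)
  have gxw: "gdiff x w \<le> 5 / 2 * L * Dr + 5 * L\<^sup>2 * A"
    unfolding Dr_def A_def by (rule gdiff_reference)
  have gxy: "gdiff x y \<le> 5 / 2 * L * Ds + 5 * L\<^sup>2 * B"
    unfolding Ds_def B_def by (rule gdiff_reference)
  have "gdiff w y \<le> 2 * gdiff w x + 2 * gdiff x y" using gdiff_triangle[of 1 w y x] by simp
  then have gwy: "gdiff w y \<le> 5 * L * Dr + 5 * L * Ds + 10 * L\<^sup>2 * A + 10 * L\<^sup>2 * B"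
    using gxw gxy gdiff_commute[of w x] by linarith
  have "\<eta> * E \<le> \<eta> * (\<omega> / real n * (2 * H + 2 * gdiff x w))"
    using e eta by (intro mult_left_mono) auto
  also have "\<dots> = 2 * k * H + 2 * k * gdiff x w" by (simp add: k_def algebra_simps)
  also have "2 * k * gdiff x w \<le> 2 * k * (5 / 2 * L * Dr + 5 * L\<^sup>2 * A)"
    using gxw k by (intro mult_left_mono) auto
  finally have E: "\<eta> * E \<le> 2 * (k * H) + 5 * (k * L * Dr) + 10 * (k * L\<^sup>2 * A)"
    by (simp add: algebra_simps)
  have "m * gdiff w y \<le> m * (5 * L * Dr + 5 * L * Ds + 10 * L\<^sup>2 * A + 10 * L\<^sup>2 * B)"
    using gwy m by (intro mult_left_mono) auto
  then have M: "m * gdiff w y \<le> 5 * (m * L * Dr) + 5 * (m * L * Ds) + 10 * (m * L\<^sup>2 * A) + 10 * (m * L\<^sup>2 * B)"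
    by (simp add: algebra_simps)
  have cE: "cE = 1 / \<eta> + 15 / 2 * (k * L\<^sup>2) + 10 * (m * L\<^sup>2)"
    by (simp add: cE_def k_def m_def)
  have pZ: "cZ * (1 - \<gamma> * \<mu>) * Z \<le> (1 - rho) * cZ * Z"
    using mult_right_mono[OF coefficient_Z nn(1)] .
  have pS: "(1 / 2 - \<theta>) * S + cW * p * S \<le> (1 - rho) * S"
    using mult_right_mono[OF coefficient_S nn(2)] by (simp add: algebra_simps)
  have pR: "R / 2 + cW * (1 - p) * R \<le> (1 - rho) * cW * R"
    using mult_right_mono[OF coefficient_R nn(3)] by (simp add: algebra_simps)
  have pH: "3 / 2 * (k * H) + cH * (1 - 1 / (\<omega> + 1) / 2) * H \<le> (1 - rho) * cH * H"
    using mult_right_mono[OF coefficient_H nn(4)] unfolding distrib_right by (simp add: k_def)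
  have pDr: "15 / 4 * (k * L * Dr) + 5 * (m * L * Dr) \<le> Dr / 2"
    using mult_right_mono[OF coefficient_breg(1) AB(3)] unfolding distrib_right
    by (simp add: k_def m_def mult_ac)
  have pDs: "5 * (m * L * Ds) \<le> (1 / 2 - \<theta>) * Ds"
    using mult_right_mono[OF coefficient_breg(2) AB(4)] by (simp add: m_def mult_ac)
  have pA: "cE * A + cA * (1 - p) * A \<le> (1 - rho) * cA * A"
    using mult_right_mono[OF coefficient_A AB(1)] unfolding distrib_right .
  have pB: "cE * B + cA * p * B \<le> (1 - rho) * cC * B"
    using mult_right_mono[OF coefficient_C AB(2)] unfolding distrib_right .
  have kL: "0 \<le> k * L\<^sup>2 * B" using k AB by simp
  have cEA: "cE * A = 1 / \<eta> * A + 15 / 2 * (k * L\<^sup>2 * A) + 10 * (m * L\<^sup>2 * A)"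
    and cEB: "cE * B = 1 / \<eta> * B + 15 / 2 * (k * L\<^sup>2 * B) + 10 * (m * L\<^sup>2 * B)"
    unfolding cE by (simp_all only: distrib_right mult.assoc)
  have expand: "1 / \<eta> * (A + B) = 1 / \<eta> * A + 1 / \<eta> * B" "3 / 4 * \<eta> * E = 3 / 4 * (\<eta> * E)"
    "cW * (p * S + (1 - p) * R) = cW * p * S + cW * (1 - p) * R"
    "cH * ((1 - 1 / (\<omega> + 1) / 2) * H + p * q * gdiff w y) = cH * (1 - 1 / (\<omega> + 1) / 2) * H + m * gdiff w y"
    "cA * (p * B + (1 - p) * A) = cA * p * B + cA * (1 - p) * A"
    "(1 - rho) * (cZ * Z + S + cW * R + cH * H + cA * A + cC * B)
      = (1 - rho) * cZ * Z + (1 - rho) * S + (1 - rho) * cW * R + (1 - rho) * cH * H + (1 - rho) * cA * A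
        + (1 - rho) * cC * B"
    by (simp_all only: distrib_left mult.assoc m_def)
  \<comment> \<open>With every product abstracted to a variable, the claim is a linear
    inequality.\<close>
  have combine: "z1 + R / 2 + s1 - Dr / 2 - ds + (ia + ib) + 3 / 4 * e + (s2 + r2) + (h1 + g) + (b3 + a3)
      \<le> z2 + s3 + r3 + h2 + a4 + b4"
    if "e \<le> 2 * kH + 5 * kD + 10 * kA" "g \<le> 5 * mD + 5 * mS + 10 * mA + 10 * mB" "z1 \<le> z2" "s1 + s2 \<le> s3"
      "R / 2 + r2 \<le> r3" "3 / 2 * kH + h1 \<le> h2" "15 / 4 * kD + 5 * mD \<le> Dr / 2" "5 * mS \<le> ds"
      "eA + a3 \<le> a4" "eB + b3 \<le> b4" "0 \<le> kB" "eA = ia + 15 / 2 * kA + 10 * mA" "eB = ib + 15 / 2 * kB + 10 * mB"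
    for z1 z2 s1 s2 s3 r2 r3 e kH kD kA g mD mS mA mB h1 h2 ds eA eB a3 a4 b3 b4 kB ia ib :: real
    using that by argo
  show ?thesis
    unfolding A_def[symmetric] B_def[symmetric] Dr_def[symmetric] Ds_def[symmetric] expand
    by (rule combine[OF E M pZ pS pR pH pDr pDs pA pB kL cEA cEB])
qed

end

section \<open>Expected decrease of the Lyapunov function\<close>

context adiana_params
begin

definition shift_error :: "'a adiana_state \<Rightarrow> real" where
  "shift_error st = (1 / real n) * (\<Sum>i<n. (norm (shift st i - gradf i (wvec st)))\<^sup>2)"

definition lyap :: "'a adiana_state \<Rightarrow> 'a \<Rightarrow> 'a \<Rightarrow> real" where
  "lyap st r s = cZ * (norm (zvec st - xstar))\<^sup>2 + gap s + cW * gap r + cH * shift_error st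
     + cA * (norm (wvec st - r))\<^sup>2 + cC * (norm (yvec st - s))\<^sup>2"

abbreviation step :: "(nat \<Rightarrow> 'a \<Rightarrow> 'a) \<Rightarrow> bool \<Rightarrow> 'a adiana_state \<Rightarrow> 'a adiana_state" where
  "step \<equiv> adiana_step n gradf \<psi> \<eta> \<theta> (1 / 2) (1 / (\<omega> + 1)) (1 - \<gamma> * \<mu>) \<gamma>"

lemma lyap_lower:
  assumes "\<psi> r \<noteq> \<infinity>" "\<psi> s \<noteq> \<infinity>"
  shows "cZ * (norm (zvec st - xstar))\<^sup>2 \<le> lyap st r s"
proof -
  have "0 \<le> gap s" "0 \<le> gap r" using assms gap_nonneg by auto
  moreover have "0 \<le> shift_error st" by (simp add: shift_error_def sum_nonneg)
  moreover have "0 \<le> cA" "0 \<le> cC" using cE_pos p by (auto simp: cA_def cC_def)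
  ultimately show ?thesis using cH_nonneg cW_pos by (simp add: lyap_def)
qed

lemma lyap_nonneg:
  assumes "\<psi> r \<noteq> \<infinity>" "\<psi> s \<noteq> \<infinity>"
  shows "0 \<le> lyap st r s"
  using order_trans[OF _ lyap_lower[OF assms]] cZ_pos by simp

text \<open>If the coin falls, the target gradients jump from \<open>w\<close> to \<open>y\<close>,
  and Young's inequality with weight \<open>1 / (q - 1)\<close> gives the factors
  \<open>1 + 1 / (q - 1)\<close> and \<open>q\<close>. The form is linear in the coin so that
  expectations can be taken.\<close>

lemma shift_error_step:
  assumes "wvec st' = (if b then y else w)"
  shows "shift_error st' \<le> (1 / real n) * (\<Sum>i<n. (norm (shift st' i - gradf i w))\<^sup>2)
     + of_bool b * (1 / (q - 1) * ((1 / real n) * (\<Sum>i<n. (norm (shift st' i - gradf i w))\<^sup>2)) + q * gdiff w y)"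
proof (cases b)
  case True
  have q1: "q - 1 > 0" using p omega by (simp add: q_def)
  have "(\<Sum>i<n. (norm (shift st' i - gradf i y))\<^sup>2)
    \<le> (\<Sum>i<n. (1 + 1 / (q - 1)) * (norm (shift st' i - gradf i w))\<^sup>2 + q * (norm (gradf i w - gradf i y))\<^sup>2)"
  proof (rule sum_mono)
    fix i
    show "(norm (shift st' i - gradf i y))\<^sup>2
      \<le> (1 + 1 / (q - 1)) * (norm (shift st' i - gradf i w))\<^sup>2 + q * (norm (gradf i w - gradf i y))\<^sup>2"
      using norm_add_square_le[of "1 / (q - 1)" "shift st' i - gradf i w" "gradf i w - gradf i y"] q1
      by simp
  qed
  also have "\<dots> = (1 + 1 / (q - 1)) * (\<Sum>i<n. (norm (shift st' i - gradf i w))\<^sup>2)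
      + q * (\<Sum>i<n. (norm (gradf i w - gradf i y))\<^sup>2)"
    by (simp only: sum.distrib sum_distrib_left)
  finally have "(1 / real n) * (\<Sum>i<n. (norm (shift st' i - gradf i y))\<^sup>2)
    \<le> (1 / real n) * ((1 + 1 / (q - 1)) * (\<Sum>i<n. (norm (shift st' i - gradf i w))\<^sup>2)
      + q * (\<Sum>i<n. (norm (gradf i w - gradf i y))\<^sup>2))"
    by (intro mult_left_mono) auto
  also have "\<dots> = (1 / real n) * (\<Sum>i<n. (norm (shift st' i - gradf i w))\<^sup>2)
     + (1 / (q - 1) * ((1 / real n) * (\<Sum>i<n. (norm (shift st' i - gradf i w))\<^sup>2)) + q * gdiff w y)"
  proof -
    have "a * ((1 + k) * S + q * G) = a * S + (k * (a * S) + q * (a * G))" for a k S G :: real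
      by algebra
    then show ?thesis unfolding gdiff_def .
  qed
  finally show ?thesis using True assms by (simp add: shift_error_def)
qed (simp add: shift_error_def assms)

text \<open>The state is fixed and only the seeds and the coin of one iteration are random.
  Pointwise, the new Lyapunov value is at most \<open>bound\<close>, which is linear in
  \<open>e\<close>, \<open>(norm e)\<^sup>2\<close>, \<open>T\<close>, \<open>B\<close> and
  \<open>B * T\<close>; the error \<open>e\<close> is centered, and the coin \<open>B\<close> is
  independent of each summand of \<open>T\<close>.\<close>

lemma expected_step:
  fixes c :: "nat \<Rightarrow> 'w \<Rightarrow> 'a \<Rightarrow> 'a" and b :: "'w \<Rightarrow> bool" and st :: "'a adiana_state"
  assumes M: "prob_space M"
    and comp: "\<And>i. i < n \<Longrightarrow> compression_operator \<omega> M (c i)"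
    and ind: "\<And>i j d d'. i < n \<Longrightarrow> j < n \<Longrightarrow> i \<noteq> j \<Longrightarrow>
       prob_space.indep_var M borel (\<lambda>\<xi>. c i \<xi> d) borel (\<lambda>\<xi>. c j \<xi> d')"
    and b: "Measurable.pred M b"
    and indb: "\<And>i d (\<phi> :: 'a \<Rightarrow> real). i < n \<Longrightarrow> \<phi> \<in> borel_measurable borel \<Longrightarrow>
       prob_space.indep_var M borel (\<lambda>\<xi>. \<phi> (c i \<xi> d)) borel (\<lambda>\<xi>. of_bool (b \<xi>))"
    and pb: "measure M {\<xi> \<in> space M. b \<xi>} = p"
    and hs: "server_shift st = (1 / real n) *\<^sub>R (\<Sum>i<n. shift st i)"
    and r: "\<psi> r \<noteq> \<infinity>" and s: "\<psi> s \<noteq> \<infinity>"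
  shows "(\<integral>\<^sup>+\<xi>. ennreal (lyap (step (\<lambda>i. c i \<xi>) (b \<xi>) st) (if b \<xi> then s else r)
            (yvec (step (\<lambda>i. c i \<xi>) (b \<xi>) st))) \<partial>M) \<le> ennreal ((1 - rho) * lyap st r s)"
proof -
  interpret prob_space M by (rule M)
  define z y w h where [simp]: "z = zvec st" "y = yvec st" "w = wvec st" "h = shift st"
  define x where "x = \<theta> *\<^sub>R z + (1 / 2) *\<^sub>R w + (1 - \<theta> - 1 / 2) *\<^sub>R y"
  define ub where "ub = \<theta> *\<^sub>R xstar + (1 / 2) *\<^sub>R r + (1 / 2 - \<theta>) *\<^sub>R s"
  define d where "d i = gradf i x - h i" for i
  define X where "X i \<xi> = c i \<xi> (d i) - d i" for i \<xi>
  define e where "e \<xi> = (1 / real n) *\<^sub>R (\<Sum>i<n. X i \<xi>)" for \<xi>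
  define Q where "Q i \<xi> = (norm ((1 / (\<omega> + 1)) *\<^sub>R c i \<xi> (gradf i w - h i) - (gradf i w - h i)))\<^sup>2" for i \<xi>
  define T where "T \<xi> = (1 / real n) * (\<Sum>i<n. Q i \<xi>)" for \<xi>
  define B where "B \<xi> = (of_bool (b \<xi>) :: real)" for \<xi>
  define st' where "st' \<xi> = step (\<lambda>i. c i \<xi>) (b \<xi>) st" for \<xi>
  define K where "K = cZ * (1 - \<gamma> * \<mu>) * (norm (z - xstar))\<^sup>2 + gap r / 2 + (1 / 2 - \<theta>) * gap s
       - breg r x / 2 - (1 / 2 - \<theta>) * breg s x
       + 1 / \<eta> * ((norm (w - r))\<^sup>2 + (norm (y - s))\<^sup>2)"
  define bound where "bound \<xi> = K + inner (e \<xi>) (ub - x) + 3 / 4 * \<eta> * (norm (e \<xi>))\<^sup>2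
      + cW * (gap r + B \<xi> * (gap s - gap r)) + cH * (T \<xi> + (1 / (q - 1) * (B \<xi> * T \<xi>) + q * gdiff w y * B \<xi>))
      + cA * ((norm (w - r))\<^sup>2 + B \<xi> * ((norm (y - s))\<^sup>2 - (norm (w - r))\<^sup>2))" for \<xi>
  have g: "(1 / real n) *\<^sub>R (\<Sum>i<n. c i \<xi> (gradf i x - h i)) + server_shift st = gavg x + e \<xi>" for \<xi>
    unfolding hs e_def X_def d_def gavg_def by (simp add: sum_subtractf sum.distrib algebra_simps)
  have x': "x = \<theta> *\<^sub>R z + (1 / 2) *\<^sub>R w + (1 / 2 - \<theta>) *\<^sub>R y" by (simp add: x_def)
  have y': "yvec (st' \<xi>) = prox \<eta> \<psi> (x - \<eta> *\<^sub>R (gavg x + e \<xi>))" for \<xi>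
    by (simp add: st'_def adiana_step_def Let_def flip: g) (simp add: x_def)
  have z': "zvec (st' \<xi>) = (1 - \<gamma> * \<mu>) *\<^sub>R z + (\<gamma> * \<mu>) *\<^sub>R x + (\<gamma> / \<eta>) *\<^sub>R (yvec (st' \<xi>) - x)" for \<xi>
    by (simp add: st'_def adiana_step_def Let_def x_def)
  have w': "wvec (st' \<xi>) = (if b \<xi> then y else w)" for \<xi>
    by (simp add: st'_def adiana_step_def Let_def)
  have h': "(1 / real n) * (\<Sum>i<n. (norm (shift (st' \<xi>) i - gradf i w))\<^sup>2) = T \<xi>" for \<xi>
    unfolding T_def Q_def by (simp add: st'_def adiana_step_def Let_def algebra_simps)
  have dom': "\<psi> (yvec (st' \<xi>)) \<noteq> \<infinity>" for \<xi> unfolding y' by (rule prox_dom[OF eta])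
  have le: "lyap (st' \<xi>) (if b \<xi> then s else r) (yvec (st' \<xi>)) \<le> bound \<xi>" for \<xi>
  proof -
    have 1: "gap (yvec (st' \<xi>)) + cZ * (norm (zvec (st' \<xi>) - xstar))\<^sup>2
        \<le> K + inner (e \<xi>) (ub - x) + 3 / 4 * \<eta> * (norm (e \<xi>))\<^sup>2"
      unfolding K_def by (rule pointwise_descent[OF x' y' z' ub_def r s])
    have 2: "shift_error (st' \<xi>) \<le> T \<xi> + (1 / (q - 1) * (B \<xi> * T \<xi>) + q * gdiff w y * B \<xi>)"
      using shift_error_step[OF w'[of \<xi>]] unfolding h' by (auto simp: B_def)
    have 3: "gap (if b \<xi> then s else r) = gap r + B \<xi> * (gap s - gap r)"
      by (simp add: B_def)
    have 4: "(norm (wvec (st' \<xi>) - (if b \<xi> then s else r)))\<^sup>2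
        = (norm (w - r))\<^sup>2 + B \<xi> * ((norm (y - s))\<^sup>2 - (norm (w - r))\<^sup>2)"
      by (simp add: B_def w')
    show ?thesis unfolding lyap_def bound_def 3 4 using 1 mult_left_mono[OF 2 cH_nonneg] by simp
  qed
  have Xc: "integrable M (X i)" "expectation (X i) = 0" "integrable M (\<lambda>\<xi>. (norm (X i \<xi>))\<^sup>2)"
    "expectation (\<lambda>\<xi>. (norm (X i \<xi>))\<^sup>2) \<le> \<omega> * (norm (d i))\<^sup>2" if "i < n" for i
    using compression_moments[OF comp[OF that], of "d i"] omega unfolding X_def
    by (auto simp: prob_space)
  have Xi: "indep_var borel (X i) borel (X j)" if "i < n" "j < n" "i \<noteq> j" for i j
    using indep_var_compose[OF ind[OF that, of "d i" "d j"], of "\<lambda>v. v - d i" borel "\<lambda>v. v - d j" borel]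
    by (simp add: o_def X_def[abs_def])
  have ei: "integrable M e" "expectation e = 0"
    unfolding e_def[abs_def] using Xc by (auto intro!: Bochner_Integration.integrable_sum)
  have esq: "(norm (e \<xi>))\<^sup>2 = (1 / real n)\<^sup>2 * (norm (\<Sum>i<n. X i \<xi>))\<^sup>2" for \<xi>
    by (simp add: e_def power_mult_distrib power_divide)
  have cs: "integrable M (\<lambda>\<xi>. (norm (\<Sum>i<n. X i \<xi>))\<^sup>2)"
    "expectation (\<lambda>\<xi>. (norm (\<Sum>i<n. X i \<xi>))\<^sup>2) = (\<Sum>i<n. expectation (\<lambda>\<xi>. (norm (X i \<xi>))\<^sup>2))"
    by (rule centered_sum_square; use Xc Xi in auto)+
  have e2: "integrable M (\<lambda>\<xi>. (norm (e \<xi>))\<^sup>2)"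
    unfolding esq using cs(1) by simp
  have "expectation (\<lambda>\<xi>. (norm (e \<xi>))\<^sup>2) = (1 / real n)\<^sup>2 * (\<Sum>i<n. expectation (\<lambda>\<xi>. (norm (X i \<xi>))\<^sup>2))"
    unfolding esq using cs by simp
  also have "\<dots> \<le> (1 / real n)\<^sup>2 * (\<Sum>i<n. \<omega> * (2 * (norm (h i - gradf i w))\<^sup>2 + 2 * (norm (gradf i x - gradf i w))\<^sup>2))"
  proof (intro mult_left_mono sum_mono)
    fix i assume "i \<in> {..<n}"
    then have "expectation (\<lambda>\<xi>. (norm (X i \<xi>))\<^sup>2) \<le> \<omega> * (norm (d i))\<^sup>2" using Xc(4) by simp
    \<comment> \<open>\<open>d i\<close> is the difference of \<open>gradf i x - gradf i w\<close>
      and the shift error of machine \<open>i\<close>.\<close>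
    also have "(norm (d i))\<^sup>2 \<le> 2 * (norm (h i - gradf i w))\<^sup>2 + 2 * (norm (gradf i x - gradf i w))\<^sup>2"
      using norm_add_square_le[of 1 "gradf i w - h i" "gradf i x - gradf i w"]
      by (simp add: d_def norm_minus_commute)
    finally show "expectation (\<lambda>\<xi>. (norm (X i \<xi>))\<^sup>2)
        \<le> \<omega> * (2 * (norm (h i - gradf i w))\<^sup>2 + 2 * (norm (gradf i x - gradf i w))\<^sup>2)"
      using omega by (simp add: mult_left_mono)
  qed simp
  also have "\<dots> = \<omega> / real n * (2 * shift_error st + 2 * gdiff x w)"
    by (simp add: shift_error_def gdiff_def sum.distrib power2_eq_square algebra_simps flip: sum_distrib_left)
  finally have E2: "expectation (\<lambda>\<xi>. (norm (e \<xi>))\<^sup>2) \<le> \<omega> / real n * (2 * shift_error st + 2 * gdiff x w)" .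
  note b [measurable]
  have Bi: "integrable M B" "expectation B = p"
  proof -
    have ev: "{\<xi> \<in> space M. b \<xi>} \<in> events" by measurable
    have ind: "B \<xi> = indicator {\<xi> \<in> space M. b \<xi>} \<xi>" if "\<xi> \<in> space M" for \<xi>
      using that by (simp add: B_def indicator_def)
    have "integrable M B \<longleftrightarrow> integrable M (indicator {\<xi> \<in> space M. b \<xi>} :: 'w \<Rightarrow> real)"
      "expectation B = expectation (indicator {\<xi> \<in> space M. b \<xi>})"
      by (intro Bochner_Integration.integrable_cong Bochner_Integration.integral_cong refl ind; assumption)+
    with ev pb show "integrable M B" "expectation B = p"
      by (auto simp: emeasure_eq_measure)
  qed
  have Qi: "integrable M (Q i)" "expectation (Q i) \<le> (1 - 1 / (\<omega> + 1)) * (norm (gradf i w - h i))\<^sup>2" if "i < n" for i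
    unfolding Q_def[abs_def] by (rule compression_affine_square[OF comp[OF that] omega])+
  have QB: "indep_var borel (Q i) borel B" if "i < n" for i
    using indb[OF that, of "\<lambda>v. (norm ((1 / (\<omega> + 1)) *\<^sub>R v - (gradf i w - h i)))\<^sup>2" "gradf i w - h i"]
    by (simp add: Q_def[abs_def] B_def[abs_def])
  have Ti: "integrable M T" unfolding T_def[abs_def]
    by (intro integrable_mult_right Bochner_Integration.integrable_sum Qi(1)) auto
  have ET: "expectation T \<le> (1 - 1 / (\<omega> + 1)) * shift_error st"
  proof -
    have "expectation T = (1 / real n) * (\<Sum>i<n. expectation (Q i))"
      unfolding T_def[abs_def] using Qi by simp
    also have "\<dots> \<le> (1 / real n) * (\<Sum>i<n. (1 - 1 / (\<omega> + 1)) * (norm (gradf i w - h i))\<^sup>2)"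
      using Qi by (intro mult_left_mono sum_mono) auto
    also have "\<dots> = (1 - 1 / (\<omega> + 1)) * shift_error st"
      by (simp add: shift_error_def norm_minus_commute flip: sum_distrib_left)
    finally show ?thesis .
  qed
  have BT: "B \<xi> * T \<xi> = (1 / real n) * (\<Sum>i<n. Q i \<xi> * B \<xi>)" for \<xi>
    by (simp add: T_def sum_distrib_left mult_ac)
  have QBi: "integrable M (\<lambda>\<xi>. Q i \<xi> * B \<xi>)" "expectation (\<lambda>\<xi>. Q i \<xi> * B \<xi>) = expectation (Q i) * p" if "i < n" for i
    using indep_var_integrable[OF QB[OF that] Qi(1)[OF that] Bi(1)]
      indep_var_lebesgue_integral[OF QB[OF that] Qi(1)[OF that] Bi(1)] Bi(2) by simp_all
  have BTi: "integrable M (\<lambda>\<xi>. B \<xi> * T \<xi>)" unfolding BT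
    by (intro integrable_mult_right Bochner_Integration.integrable_sum QBi(1)) auto
  have EBT: "expectation (\<lambda>\<xi>. B \<xi> * T \<xi>) = p * expectation T"
    unfolding BT using QBi Qi by (simp add: T_def[abs_def] mult.commute sum_distrib_left)
  have int: "integrable M bound"
    unfolding bound_def[abs_def]
    by (intro Bochner_Integration.integrable_add integrable_mult_right integrable_mult_left integrable_const
        integrable_inner_left ei(1) e2 Bi(1) Ti BTi)
  have E: "expectation bound = K + 3 / 4 * \<eta> * expectation (\<lambda>\<xi>. (norm (e \<xi>))\<^sup>2)
      + cW * (p * gap s + (1 - p) * gap r)
      + cH * ((1 + 1 / (q - 1) * p) * expectation T + p * q * gdiff w y)
      + cA * (p * (norm (y - s))\<^sup>2 + (1 - p) * (norm (w - r))\<^sup>2)"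
  proof -
    have "expectation bound = K + 0 + 3 / 4 * \<eta> * expectation (\<lambda>\<xi>. (norm (e \<xi>))\<^sup>2)
      + cW * (gap r + p * (gap s - gap r))
      + cH * (expectation T + (1 / (q - 1) * (p * expectation T) + q * gdiff w y * p))
      + cA * ((norm (w - r))\<^sup>2 + p * ((norm (y - s))\<^sup>2 - (norm (w - r))\<^sup>2))"
      unfolding bound_def[abs_def] using ei e2 Bi Ti BTi EBT
      by (simp add: prob_space)
    then show ?thesis by (simp add: algebra_simps)
  qed
  have "(1 + 1 / (q - 1) * p) * expectation T \<le> (1 + 1 / (q - 1) * p) * ((1 - 1 / (\<omega> + 1)) * shift_error st)"
    using ET q_ge_1 p by (intro mult_left_mono) auto
  also have "\<dots> = ((1 + 1 / (q - 1) * p) * (1 - 1 / (\<omega> + 1))) * shift_error st" by simp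
  also have "\<dots> \<le> (1 - 1 / (\<omega> + 1) / 2) * shift_error st"
  proof (rule mult_right_mono)
    have "q - 1 = 2 * p * (\<omega> + 1)" by (simp add: q_def)
    \<comment> \<open>The choice of \<open>q\<close> turns the factor into
      \<open>(1 + t / 2) * (1 - t)\<close> with \<open>t = 1 / (\<omega> + 1)\<close>.\<close>
    then have eq: "1 / (q - 1) * p = 1 / (\<omega> + 1) / 2" using p by (simp only:) simp
    have "(1 + t / 2) * (1 - t) \<le> 1 - t / 2" if "0 \<le> t" for t :: real
      using that by (simp add: algebra_simps)
    from this[of "1 / (\<omega> + 1)"] show "(1 + 1 / (q - 1) * p) * (1 - 1 / (\<omega> + 1)) \<le> 1 - 1 / (\<omega> + 1) / 2"
      unfolding eq using omega by simp
  qed (simp add: shift_error_def sum_nonneg)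
  finally have T2: "(1 + 1 / (q - 1) * p) * expectation T \<le> (1 - 1 / (\<omega> + 1) / 2) * shift_error st" .
  have "expectation bound \<le> K + 3 / 4 * \<eta> * expectation (\<lambda>\<xi>. (norm (e \<xi>))\<^sup>2)
      + cW * (p * gap s + (1 - p) * gap r)
      + cH * ((1 - 1 / (\<omega> + 1) / 2) * shift_error st + p * q * gdiff w y)
      + cA * (p * (norm (y - s))\<^sup>2 + (1 - p) * (norm (w - r))\<^sup>2)"
    unfolding E using T2 by (intro add_mono mult_left_mono order_refl cH_nonneg) auto
  also have "\<dots> \<le> (1 - rho) * (cZ * (norm (z - xstar))\<^sup>2 + gap s + cW * gap r + cH * shift_error st
      + cA * (norm (w - r))\<^sup>2 + cC * (norm (y - s))\<^sup>2)"
    unfolding K_def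
    by (rule lyapunov_bound) (use gap_nonneg r s E2 in \<open>auto simp: shift_error_def sum_nonneg\<close>)
  also have "\<dots> = (1 - rho) * lyap st r s" by (simp add: lyap_def)
  finally have fin: "expectation bound \<le> (1 - rho) * lyap st r s" .
  \<comment> \<open>\<open>bound\<close> dominates a nonnegative Lyapunov value, so its nonnegative
    integral is its expectation.\<close>
  have nn: "0 \<le> bound \<xi>" for \<xi>
    by (rule order_trans[OF lyap_nonneg le]) (use r s dom' in auto)
  have "(\<integral>\<^sup>+\<xi>. ennreal (lyap (st' \<xi>) (if b \<xi> then s else r) (yvec (st' \<xi>))) \<partial>M) \<le> (\<integral>\<^sup>+\<xi>. ennreal (bound \<xi>) \<partial>M)"
    by (intro nn_integral_mono ennreal_leI le)
  also have "\<dots> = ennreal (expectation bound)"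
    using int nn by (intro nn_integral_eq_integral) auto
  also have "\<dots> \<le> ennreal ((1 - rho) * lyap st r s)" by (rule ennreal_leI[OF fin])
  finally show ?thesis unfolding st'_def .
qed

end

section \<open>Randomness of a run\<close>

text \<open>Sublevel sets at finite levels are sections of the closed epigraph, hence
  closed.\<close>

lemma proper_closed_convex_measurable:
  fixes \<psi> :: "'a::euclidean_space \<Rightarrow> ereal"
  assumes "proper_closed_convex \<psi>"
  shows "\<psi> \<in> borel_measurable borel"
  unfolding borel_measurable_iff_Iic_ereal
proof
  fix a :: ereal
  have "\<psi> -` {..a} \<in> sets borel"
  proof (cases a)
    case (real r)
    have "closed {(x, r :: real). \<psi> x \<le> ereal r}" using assms by (simp add: proper_closed_convex_def)
    then have "closed ((\<lambda>x. (x, r)) -` {(x, r :: real). \<psi> x \<le> ereal r})"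
      by (rule closed_vimage) (intro continuous_intros)
    then show ?thesis using real by (simp add: vimage_def)
  next
    case MInf
    then have "\<psi> -` {..a} = {}" using assms by (auto simp: proper_closed_convex_def)
    then show ?thesis by simp
  next
    case PInf
    then have "\<psi> -` {..a} = UNIV" by auto
    then show ?thesis by simp
  qed
  then show "\<psi> -` {..a} \<inter> space borel \<in> sets borel" by simp
qed

lemma Int_stable_vimages: "Int_stable {g -` A \<inter> \<Omega> | A. A \<in> sets N}"
proof (rule Int_stableI, clarify)
  fix A B assume "A \<in> sets N" "B \<in> sets N"
  then have "A \<inter> B \<in> sets N" by blast
  moreover have "(g -` A \<inter> \<Omega>) \<inter> (g -` B \<inter> \<Omega>) = g -` (A \<inter> B) \<inter> \<Omega>" by blast
  ultimately show "\<exists>D. (g -` A \<inter> \<Omega>) \<inter> (g -` B \<inter> \<Omega>) = g -` D \<inter> \<Omega> \<and> D \<in> sets N" by blast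
qed

context adiana_problem
begin

lemma gap_measurable [measurable]: "gap \<in> borel_measurable borel"
proof -
  have "continuous_on UNIV (f i)" if "i < n" for i
    using grad[OF that] unfolding gderiv_def
    by (meson continuous_at_imp_continuous_on has_derivative_continuous)
  then have "continuous_on UNIV favg" unfolding favg_def[abs_def] by (intro continuous_intros) auto
  then have [measurable]: "favg \<in> borel_measurable borel" by (rule borel_measurable_continuous_onI)
  note proper_closed_convex_measurable[OF psi, measurable]
  show ?thesis unfolding gap_def[abs_def] by measurable
qed

lemma gradf_measurable [measurable (raw)]:
  "i < n \<Longrightarrow> g \<in> borel_measurable N \<Longrightarrow> (\<lambda>x. gradf i (g x)) \<in> borel_measurable N"
  using lipschitz_on_continuous_on[OF lipschitz] borel_measurable_continuous_onI measurable_compose by blast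

end

locale adiana_run = adiana_params f gradf \<psi> xstar n L \<mu> \<omega> \<eta> \<theta> p \<gamma> + prob_space M
  for f :: "nat \<Rightarrow> 'a::euclidean_space \<Rightarrow> real" and gradf \<psi> xstar n L \<mu> \<omega> \<eta> \<theta> p \<gamma> and M :: "'w measure" +
  fixes S :: "nat \<Rightarrow> nat \<Rightarrow> 's measure" and \<xi> :: "nat \<Rightarrow> nat \<Rightarrow> 'w \<Rightarrow> 's" and b :: "nat \<Rightarrow> 'w \<Rightarrow> bool"
    and C :: "nat \<Rightarrow> nat \<Rightarrow> 's \<Rightarrow> 'a \<Rightarrow> 'a" and x0 :: 'a and h0 :: "nat \<Rightarrow> 'a"
  assumes random: "independent_randomness M n S \<xi> b"
    and C_measurable: "\<And>i k. i < n \<Longrightarrow> (\<lambda>(s, v). C i k s v) \<in> borel_measurable (S i k \<Otimes>\<^sub>M borel)"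
    and compression: "\<And>i k. i < n \<Longrightarrow> compression_operator \<omega> M (\<lambda>s. C i k (\<xi> i k s))"
    and coin: "\<And>k. measure M {s \<in> space M. b k s} = p"
begin

section \<open>The \<sigma>-algebras generated by seeds and coins, and their independence\<close>

definition events_of :: "(nat \<times> nat) + nat \<Rightarrow> 'w set set" where
  "events_of j = (case j of Inl (i, k) \<Rightarrow> {\<xi> i k -` A \<inter> space M | A. A \<in> sets (S i k)}
            | Inr k \<Rightarrow> {b k -` B \<inter> space M | B. B \<in> sets (count_space UNIV)})"

definition all_sources :: "((nat \<times> nat) + nat) set" where "all_sources = ({..<n} \<times> UNIV) <+> UNIV"
text \<open>The sources of the iterations before \<open>k\<close>, which determine
  \<open>iterate k\<close>; those in \<open>now k\<close> drive the passage to
  \<open>iterate (Suc k)\<close>.\<close>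

definition past :: "nat \<Rightarrow> ((nat \<times> nat) + nat) set" where "past k = ({..<n} \<times> {..<k}) <+> {..<k}"
definition now :: "nat \<Rightarrow> ((nat \<times> nat) + nat) set" where "now k = ({..<n} \<times> {k}) <+> {k}"

text \<open>Serves only as a carrier of a \<sigma>-algebra; integrals are taken with respect to
  \<open>M\<close> or its image under the identity.\<close>

definition gen :: "((nat \<times> nat) + nat) set \<Rightarrow> 'w measure" where
  "gen J = sigma (space M) (\<Union>j\<in>J. events_of j)"

lemma events_of_subset: "(\<Union>j\<in>J. events_of j) \<subseteq> Pow (space M)"
  by (auto simp: events_of_def split: sum.splits prod.splits)

lemma space_gen [simp]: "space (gen J) = space M"
  unfolding gen_def by (rule space_measure_of[OF events_of_subset])

lemma sets_gen: "sets (gen J) = sigma_sets (space M) (\<Union>j\<in>J. events_of j)"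
  unfolding gen_def by (rule sets_measure_of[OF events_of_subset])

lemma gen_mono: "J \<subseteq> J' \<Longrightarrow> sets (gen J) \<subseteq> sets (gen J')"
  unfolding sets_gen by (rule sigma_sets_mono') blast

lemma indep_events_of: "indep_sets events_of all_sources"
  using random unfolding independent_randomness_def events_of_def[abs_def] all_sources_def by (elim conjE)

lemma gen_subset: "J \<subseteq> all_sources \<Longrightarrow> sets (gen J) \<subseteq> sets M"
  unfolding sets_gen using indep_events_of
  by (intro sets.sigma_sets_subset) (auto simp: indep_sets_def)

lemma measurable_gen_mono: "J \<subseteq> J' \<Longrightarrow> g \<in> measurable (gen J) N \<Longrightarrow> g \<in> measurable (gen J') N"
  using measurable_mono[OF order_refl refl gen_mono, of J J' N] by auto

lemma measurable_gen: "J \<subseteq> all_sources \<Longrightarrow> g \<in> measurable (gen J) N \<Longrightarrow> g \<in> measurable M N"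
  using measurable_mono[OF order_refl refl gen_subset, of J N] by auto

lemma seed_measurable:
  assumes "Inl (i, k) \<in> J" "i < n"
  shows "\<xi> i k \<in> measurable (gen J) (S i k)"
proof (rule measurableI)
  have m: "\<xi> i k \<in> measurable M (S i k)" using random assms by (auto simp: independent_randomness_def)
  show "\<xi> i k w \<in> space (S i k)" if "w \<in> space (gen J)" for w
    using that measurable_space[OF m] by simp
  fix A assume "A \<in> sets (S i k)"
  then have "\<xi> i k -` A \<inter> space M \<in> events_of (Inl (i, k))" by (auto simp: events_of_def)
  then show "\<xi> i k -` A \<inter> space (gen J) \<in> sets (gen J)"
    using assms(1) unfolding sets_gen space_gen by (intro sigma_sets.Basic) blast
qed

lemma coin_measurable:
  assumes "Inr k \<in> J"
  shows "b k \<in> measurable (gen J) (count_space UNIV)"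
proof (rule measurableI)
  fix A :: "bool set"
  have "b k -` A \<inter> space M \<in> events_of (Inr k)" by (auto simp: events_of_def)
  then show "b k -` A \<inter> space (gen J) \<in> sets (gen J)"
    using assms(1) unfolding sets_gen space_gen by (intro sigma_sets.Basic) blast
qed simp

lemma Int_stable_events_of: "Int_stable (events_of j)"
  unfolding events_of_def
  by (cases j) (simp_all only: sum.case case_prod_beta' Int_stable_vimages)

text \<open>Intersection-stable independent generators, grouped into disjoint blocks, generate
  independent \<sigma>-algebras. The identity, read as a map into \<open>gen J\<close>, turns such a
  \<sigma>-algebra into a random variable.\<close>

lemma indep_gen:
  assumes "J \<subseteq> all_sources" "J' \<subseteq> all_sources" "J \<inter> J' = {}"
  shows "indep_var (gen J) (\<lambda>w. w) (gen J') (\<lambda>w. w)"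
proof -
  have "indep_sets (\<lambda>j. sigma_sets (space M) (\<Union>i\<in>case_bool J J' j. events_of i)) UNIV"
  proof (rule indep_sets_collect_sigma)
    show "indep_sets events_of (\<Union>j\<in>UNIV. case_bool J J' j)"
      using assms by (intro indep_sets_mono_index[OF _ indep_events_of]) (auto simp: UNIV_bool)
    show "disjoint_family_on (case_bool J J') UNIV"
      using assms by (auto simp: disjoint_family_on_def split: bool.splits)
  qed (rule Int_stable_events_of)
  also have "(\<lambda>j. sigma_sets (space M) (\<Union>i\<in>case_bool J J' j. events_of i)) = case_bool (sets (gen J)) (sets (gen J'))"
    by (auto simp: fun_eq_iff sets_gen split: bool.splits)
  finally have ind: "indep_set (sets (gen J)) (sets (gen J'))" by (simp add: indep_set_def)
  have eq: "sigma_sets (space M) {(\<lambda>w. w) -` A \<inter> space M | A. A \<in> sets (gen K)} = sets (gen K)" for K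
  proof -
    have "(\<lambda>w. w) -` A \<inter> space M = A" if "A \<in> sets (gen K)" for A
      using sets.sets_into_space[OF that] by auto
    then have "{(\<lambda>w. w) -` A \<inter> space M | A. A \<in> sets (gen K)} = sets (gen K)"
      unfolding Setcompr_eq_image by simp
    then show ?thesis using sets.sigma_sets_eq[of "gen K"] by simp
  qed
  show ?thesis unfolding indep_var_eq eq
    using ind assms measurable_gen[OF _ measurable_ident] by (auto simp: id_def)
qed

lemma indep_functions:
  assumes "J \<subseteq> all_sources" "J' \<subseteq> all_sources" "J \<inter> J' = {}"
    and "g \<in> measurable (gen J) N" "g' \<in> measurable (gen J') N'"
  shows "indep_var N g N' g'"
  using indep_var_compose[OF indep_gen[OF assms(1-3)] assms(4,5)] by (simp add: o_def)

text \<open>On \<open>gen J \<Otimes>\<^sub>M gen J'\<close> the law of the pair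
  \<open>(w, w)\<close> is the product of its marginals, and Tonelli splits the integral. This
  replaces conditional expectation given the past.\<close>

lemma independent_integral:
  fixes F :: "'w \<times> 'w \<Rightarrow> ennreal"
  assumes J: "J \<subseteq> all_sources" "J' \<subseteq> all_sources" "J \<inter> J' = {}"
    and F: "F \<in> borel_measurable (gen J \<Otimes>\<^sub>M gen J')"
  shows "(\<integral>\<^sup>+w. F (w, w) \<partial>M) = (\<integral>\<^sup>+w. \<integral>\<^sup>+w'. F (w, w') \<partial>M \<partial>M)"
proof -
  let ?N = "distr M (gen J) (\<lambda>w. w)" and ?N' = "distr M (gen J') (\<lambda>w. w)"
  have m: "(\<lambda>w. w) \<in> measurable M (gen K)" if "K \<subseteq> all_sources" for K
    using measurable_gen[OF that measurable_ident] by (simp add: id_def)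
  interpret N': prob_space ?N' by (rule prob_space_distr[OF m[OF J(2)]])
  have "(\<integral>\<^sup>+w. F (w, w) \<partial>M) = (\<integral>\<^sup>+z. F z \<partial>distr M (gen J \<Otimes>\<^sub>M gen J') (\<lambda>w. (w, w)))"
    using F m J by (subst nn_integral_distr) auto
  also have "\<dots> = (\<integral>\<^sup>+z. F z \<partial>(?N \<Otimes>\<^sub>M ?N'))"
    using indep_gen[OF J] by (simp add: indep_var_distribution_eq)
  also have "\<dots> = (\<integral>\<^sup>+w. \<integral>\<^sup>+w'. F (w, w') \<partial>?N' \<partial>?N)"
    using F by (intro N'.nn_integral_fst[symmetric]) (simp cong: measurable_cong_sets sets_pair_measure_cong)
  also have "\<dots> = (\<integral>\<^sup>+w. \<integral>\<^sup>+w'. F (w, w') \<partial>?N' \<partial>M)"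
  proof (rule nn_integral_distr[OF m[OF J(1)]])
    have "F \<in> borel_measurable (gen J \<Otimes>\<^sub>M ?N')"
      using F by (simp cong: measurable_cong_sets sets_pair_measure_cong)
    then show "(\<lambda>w. \<integral>\<^sup>+w'. F (w, w') \<partial>?N') \<in> borel_measurable ?N"
      using N'.borel_measurable_nn_integral_fst by simp
  qed
  also have "\<dots> = (\<integral>\<^sup>+w. \<integral>\<^sup>+w'. F (w, w') \<partial>M \<partial>M)"
  proof (rule nn_integral_cong)
    fix w assume "w \<in> space M"
    then have "(\<lambda>w'. F (w, w')) \<in> borel_measurable (gen J')"
      using F by (intro measurable_compose[OF measurable_Pair1' F]) simp
    then show "(\<integral>\<^sup>+w'. F (w, w') \<partial>?N') = (\<integral>\<^sup>+w'. F (w, w') \<partial>M)"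
      by (intro nn_integral_distr[OF m[OF J(2)]]) simp
  qed
  finally show ?thesis .
qed

text \<open>States are records, so measurability is stated by components; shifts are restricted to
  actual machines, the only ones whose compressors are assumed measurable.\<close>

definition measurable_state :: "'v measure \<Rightarrow> ('v \<Rightarrow> 'a adiana_state) \<Rightarrow> bool" where
  "measurable_state Q X \<longleftrightarrow> (\<lambda>w. zvec (X w)) \<in> borel_measurable Q \<and> (\<lambda>w. yvec (X w)) \<in> borel_measurable Q \<and>
     (\<lambda>w. wvec (X w)) \<in> borel_measurable Q \<and> (\<lambda>w. server_shift (X w)) \<in> borel_measurable Q \<and>
     (\<forall>i<n. (\<lambda>w. shift (X w) i) \<in> borel_measurable Q)"

lemma measurable_state_step:
  assumes X: "measurable_state Q X"
    and s: "\<And>i. i < n \<Longrightarrow> s i \<in> measurable Q (S i k)" and c: "c \<in> measurable Q (count_space UNIV)"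
  shows "measurable_state Q (\<lambda>w. step (\<lambda>i. C i k (s i w)) (c w) (X w))"
proof -
  have [measurable]: "(\<lambda>w. zvec (X w)) \<in> borel_measurable Q" "(\<lambda>w. yvec (X w)) \<in> borel_measurable Q"
    "(\<lambda>w. wvec (X w)) \<in> borel_measurable Q" "(\<lambda>w. server_shift (X w)) \<in> borel_measurable Q"
    "\<And>i. i < n \<Longrightarrow> (\<lambda>w. shift (X w) i) \<in> borel_measurable Q"
    "Measurable.pred Q c"
    using X c by (auto simp: measurable_state_def)
  have Cm [measurable (raw)]: "(\<lambda>w. C i k (s i w) (v w)) \<in> borel_measurable Q"
    if "i < n" "v \<in> borel_measurable Q" for i v
    using measurable_compose[OF measurable_Pair[OF s that(2)] C_measurable[OF that(1)]] that by simp
  have [measurable]: "prox \<eta> \<psi> \<in> borel_measurable borel"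
    by (rule borel_measurable_continuous_onI[OF prox_continuous[OF eta]])
  show ?thesis unfolding measurable_state_def adiana_step_def Let_def by simp
qed

lemma measurable_lyap:
  assumes X: "measurable_state Q X" and [measurable]: "r \<in> borel_measurable Q" "s \<in> borel_measurable Q"
  shows "(\<lambda>w. lyap (X w) (r w) (s w)) \<in> borel_measurable Q"
proof -
  have [measurable]: "(\<lambda>w. zvec (X w)) \<in> borel_measurable Q" "(\<lambda>w. yvec (X w)) \<in> borel_measurable Q"
    "(\<lambda>w. wvec (X w)) \<in> borel_measurable Q"
    "\<And>i. i < n \<Longrightarrow> (\<lambda>w. shift (X w) i) \<in> borel_measurable Q"
    using X by (auto simp: measurable_state_def)
  show ?thesis unfolding lyap_def shift_error_def by measurable
qed

section \<open>The run, its reference points and the expected decrease along it\<close>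

definition iterate :: "nat \<Rightarrow> 'w \<Rightarrow> 'a adiana_state" where
  "iterate k s = adiana n gradf \<psi> \<eta> \<theta> (1 / 2) (1 / (\<omega> + 1)) (1 - \<gamma> * \<mu>) \<gamma>
     (\<lambda>i k. C i k (\<xi> i k s)) (\<lambda>k. b k s) x0 h0 k"

lemma iterate_0: "iterate 0 w = adiana_init n x0 h0" by (simp add: iterate_def)
lemma iterate_Suc: "iterate (Suc k) w = step (\<lambda>i. C i k (\<xi> i k w)) (b k w) (iterate k w)" by (simp add: iterate_def)

text \<open>From index 1 on, \<open>yvec\<close> is a value of \<open>prox\<close>, where
  \<open>\<psi>\<close> is finite, so it can serve as its own reference.\<close>

fun yref :: "nat \<Rightarrow> 'w \<Rightarrow> 'a" where
  "yref 0 w = xstar"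
| "yref (Suc k) w = yvec (iterate (Suc k) w)"

primrec wref :: "nat \<Rightarrow> 'w \<Rightarrow> 'a" where
  "wref 0 w = xstar"
| "wref (Suc k) w = (if b k w then yref k w else wref k w)"

lemma yref_dom: "\<psi> (yref k w) \<noteq> \<infinity>"
  by (cases k) (auto simp: psi_xstar iterate_Suc adiana_step_def Let_def prox_dom[OF eta])

lemma wref_dom: "\<psi> (wref k w) \<noteq> \<infinity>"
  by (induction k) (auto simp: psi_xstar yref_dom)

text \<open>This invariant makes the server's estimate equal to the average gradient plus the mean
  compression error.\<close>

lemma server_shift_iterate: "server_shift (iterate k w) = (1 / real n) *\<^sub>R (\<Sum>i<n. shift (iterate k w) i)"
proof (induction k)
  case (Suc k)
  then show ?case
    by (simp add: iterate_Suc adiana_step_def Let_def sum.distrib scaleR_add_right scaleR_sum_right[symmetric])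
qed (simp add: iterate_0 adiana_init_def)

lemma past_Suc: "past (Suc k) = past k \<union> now k"
  by (auto simp: past_def now_def less_Suc_eq)

lemma past_now: "past k \<subseteq> all_sources" "now k \<subseteq> all_sources" "past k \<inter> now k = {}"
  by (auto simp: past_def now_def all_sources_def)

lemma measurable_iterate: "measurable_state (gen (past k)) (iterate k)"
proof (induction k)
  case 0
  show ?case unfolding iterate_0[abs_def] by (simp add: measurable_state_def)
next
  case (Suc k)
  have "past k \<subseteq> past (Suc k)" by (simp add: past_Suc)
  with Suc have "measurable_state (gen (past (Suc k))) (iterate k)"
    unfolding measurable_state_def using measurable_gen_mono by blast
  then show ?case unfolding iterate_Suc[abs_def]
    by (rule measurable_state_step) (auto intro!: seed_measurable coin_measurable simp: past_def)
qed

lemma measurable_yref: "yref k \<in> borel_measurable (gen (past k))"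
proof (cases k)
  case 0
  then have "yref k = (\<lambda>w. xstar)" by auto
  then show ?thesis by simp
next
  case (Suc j)
  then have "yref k = (\<lambda>w. yvec (iterate k w))" by auto
  then show ?thesis using measurable_iterate[of k] by (simp add: measurable_state_def)
qed

lemma measurable_wref: "wref k \<in> borel_measurable (gen (past k))"
proof (induction k)
  case (Suc k)
  have "past k \<subseteq> past (Suc k)" by (simp add: past_Suc)
  note mono = measurable_gen_mono[OF this]
  note [measurable] = mono[OF Suc] mono[OF measurable_yref]
  have [measurable]: "Measurable.pred (gen (past (Suc k))) (b k)"
    by (rule coin_measurable) (auto simp: past_def)
  have "wref (Suc k) = (\<lambda>w. if b k w then yref k w else wref k w)" by auto
  then show ?case by simp
next
  case 0
  have "wref 0 = (\<lambda>w. xstar)" by auto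
  then show ?case by simp
qed

text \<open>In \<open>F (w, w')\<close> the point \<open>w\<close> carries the past and
  \<open>w'\<close> the current seeds and coin. Independence separates the two, and
  \<open>expected_step\<close> bounds the inner integral for each fixed past.\<close>

lemma expected_lyap_step:
  "(\<integral>\<^sup>+w. ennreal (lyap (iterate (Suc k) w) (wref (Suc k) w) (yref (Suc k) w)) \<partial>M)
    \<le> ennreal (1 - rho) * (\<integral>\<^sup>+w. ennreal (lyap (iterate k w) (wref k w) (yref k w)) \<partial>M)"
proof -
  define G where "G w w' = step (\<lambda>i. C i k (\<xi> i k w')) (b k w') (iterate k w)" for w w'
  define F where "F z = (case z of (w, w') \<Rightarrow> ennreal (lyap (G w w')
      (if b k w' then yref k w else wref k w) (yvec (G w w'))))" for z
  let ?Q = "gen (past k) \<Otimes>\<^sub>M gen (now k)"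
  have st: "measurable_state ?Q (\<lambda>z. iterate k (fst z))"
    using measurable_iterate[of k] unfolding measurable_state_def
    by (auto intro: measurable_compose[OF measurable_fst])
  have seeds: "(\<lambda>z. \<xi> i k (snd z)) \<in> measurable ?Q (S i k)" if "i < n" for i
    using that by (intro measurable_compose[OF measurable_snd seed_measurable]) (auto simp: now_def)
  have [measurable]: "Measurable.pred ?Q (\<lambda>z. b k (snd z))"
    by (intro measurable_compose[OF measurable_snd coin_measurable]) (auto simp: now_def)
  have G: "measurable_state ?Q (\<lambda>z. G (fst z) (snd z))"
    unfolding G_def by (rule measurable_state_step[OF st seeds]) auto
  note [measurable] = measurable_yref[of k] measurable_wref[of k]
  have "(\<lambda>z. lyap (G (fst z) (snd z)) (if b k (snd z) then yref k (fst z) else wref k (fst z)) (yvec (G (fst z) (snd z))))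
      \<in> borel_measurable ?Q"
    using G by (intro measurable_lyap[OF G]) (auto simp: measurable_state_def)
  then have F: "F \<in> borel_measurable ?Q" unfolding F_def case_prod_beta' by measurable
  have "(\<integral>\<^sup>+w. ennreal (lyap (iterate (Suc k) w) (wref (Suc k) w) (yref (Suc k) w)) \<partial>M) = (\<integral>\<^sup>+w. F (w, w) \<partial>M)"
    by (simp add: F_def G_def iterate_Suc)
  also have "\<dots> = (\<integral>\<^sup>+w. \<integral>\<^sup>+w'. F (w, w') \<partial>M \<partial>M)"
    by (rule independent_integral[OF past_now F])
  also have "\<dots> \<le> (\<integral>\<^sup>+w. ennreal ((1 - rho) * lyap (iterate k w) (wref k w) (yref k w)) \<partial>M)"
  proof (rule nn_integral_mono)
    fix w
    have Cm: "(\<lambda>w'. C i k (\<xi> i k w') d) \<in> borel_measurable (gen {Inl (i, k)})" if "i < n" for i d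
      using measurable_compose[OF measurable_Pair[OF seed_measurable measurable_const, of i k "{Inl (i, k)}"] C_measurable[OF that]] that by simp
    have src: "{Inl (i, k)} \<subseteq> all_sources" "{Inr k} \<subseteq> all_sources" if "i < n" for i
      using that by (auto simp: all_sources_def)
    have "(\<integral>\<^sup>+w'. ennreal (lyap (G w w') (if b k w' then yref k w else wref k w) (yvec (G w w'))) \<partial>M)
        \<le> ennreal ((1 - rho) * lyap (iterate k w) (wref k w) (yref k w))"
      unfolding G_def
    proof (rule expected_step)
      show "prob_space M" by unfold_locales
      show "Measurable.pred M (b k)"
        using measurable_gen[OF src(2) coin_measurable, of 0] n by simp
      show "indep_var borel (\<lambda>w'. C i k (\<xi> i k w') d) borel (\<lambda>w'. C j k (\<xi> j k w') d')"
        if "i < n" "j < n" "i \<noteq> j" for i j d d'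
        by (rule indep_functions[OF src(1) src(1) _ Cm Cm]) (use that in auto)
      show "indep_var borel (\<lambda>w'. \<phi> (C i k (\<xi> i k w') d)) borel (\<lambda>w'. of_bool (b k w'))"
        if "i < n" "\<phi> \<in> borel_measurable borel" for i d and \<phi> :: "'a \<Rightarrow> real"
      proof (rule indep_functions[OF src(1) src(2)])
        show "(\<lambda>w'. \<phi> (C i k (\<xi> i k w') d)) \<in> borel_measurable (gen {Inl (i, k)})"
          using measurable_compose[OF Cm that(2)] that(1) by simp
        show "(\<lambda>w'. of_bool (b k w')) \<in> borel_measurable (gen {Inr k})"
          using measurable_compose[OF coin_measurable[of k "{Inr k}"], of of_bool borel] by simp
      qed (use that in auto)
    qed (use compression coin server_shift_iterate yref_dom wref_dom in auto)
    then show "(\<integral>\<^sup>+w'. F (w, w') \<partial>M) \<le> ennreal ((1 - rho) * lyap (iterate k w) (wref k w) (yref k w))"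
      by (simp add: F_def)
  qed
  also have "\<dots> = (\<integral>\<^sup>+w. ennreal (1 - rho) * ennreal (lyap (iterate k w) (wref k w) (yref k w)) \<partial>M)"
    using rho_bounds(4) lyap_nonneg[OF wref_dom yref_dom] by (intro nn_integral_cong ennreal_mult) auto
  also have "\<dots> = ennreal (1 - rho) * (\<integral>\<^sup>+w. ennreal (lyap (iterate k w) (wref k w) (yref k w)) \<partial>M)"
    using measurable_gen[OF past_now(1) measurable_lyap[OF measurable_iterate measurable_wref measurable_yref]]
    by (intro nn_integral_cmult) auto
  finally show ?thesis .
qed

text \<open>Both reference points start at \<open>xstar\<close>, so the value is meaningful even if
  \<open>\<psi>\<close> is infinite at \<open>x0\<close>.\<close>

definition initial_bound :: real where "initial_bound = lyap (adiana_init n x0 h0) xstar xstar / cZ"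

lemma initial_bound_nonneg: "0 \<le> initial_bound"
  using lyap_nonneg[OF psi_xstar psi_xstar] cZ_pos by (simp add: initial_bound_def)

lemma expected_distance:
  "(\<integral>\<^sup>+w. ennreal ((norm (zvec (iterate k w) - xstar))\<^sup>2) \<partial>M) \<le> ennreal ((1 - rho) ^ k * initial_bound)"
proof -
  have rho: "0 \<le> 1 - rho" using rho_bounds(4) by simp
  have bound: "(\<integral>\<^sup>+w. ennreal (lyap (iterate k w) (wref k w) (yref k w)) \<partial>M)
    \<le> ennreal ((1 - rho) ^ k * lyap (adiana_init n x0 h0) xstar xstar)"
  proof (induction k)
    case 0
    show ?case by (simp add: iterate_0 emeasure_space_1)
  next
    case (Suc k)
    have "(\<integral>\<^sup>+w. ennreal (lyap (iterate (Suc k) w) (wref (Suc k) w) (yref (Suc k) w)) \<partial>M)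
      \<le> ennreal (1 - rho) * ennreal ((1 - rho) ^ k * lyap (adiana_init n x0 h0) xstar xstar)"
      by (rule order_trans[OF expected_lyap_step mult_left_mono[OF Suc]]) simp
    also have "\<dots> = ennreal ((1 - rho) ^ Suc k * lyap (adiana_init n x0 h0) xstar xstar)"
      using rho by (simp add: mult_ac flip: ennreal_mult')
    finally show ?case .
  qed
  have "(\<integral>\<^sup>+w. ennreal ((norm (zvec (iterate k w) - xstar))\<^sup>2) \<partial>M)
      \<le> (\<integral>\<^sup>+w. ennreal (1 / cZ) * ennreal (lyap (iterate k w) (wref k w) (yref k w)) \<partial>M)"
  proof (rule nn_integral_mono)
    fix w
    have "(norm (zvec (iterate k w) - xstar))\<^sup>2 \<le> 1 / cZ * lyap (iterate k w) (wref k w) (yref k w)"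
      using lyap_lower[OF wref_dom yref_dom, of "iterate k w" k w k w] cZ_pos by (simp add: field_simps)
    then show "ennreal ((norm (zvec (iterate k w) - xstar))\<^sup>2)
        \<le> ennreal (1 / cZ) * ennreal (lyap (iterate k w) (wref k w) (yref k w))"
      using cZ_pos by (simp add: ennreal_leI flip: ennreal_mult')
  qed
  also have "\<dots> = ennreal (1 / cZ) * (\<integral>\<^sup>+w. ennreal (lyap (iterate k w) (wref k w) (yref k w)) \<partial>M)"
    using measurable_gen[OF past_now(1) measurable_lyap[OF measurable_iterate measurable_wref measurable_yref]]
    by (intro nn_integral_cmult) auto
  also have "\<dots> \<le> ennreal (1 / cZ) * ennreal ((1 - rho) ^ k * lyap (adiana_init n x0 h0) xstar xstar)"
    by (rule mult_left_mono[OF bound]) simp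
  also have "\<dots> = ennreal ((1 - rho) ^ k * initial_bound)"
    using cZ_pos by (simp add: initial_bound_def flip: ennreal_mult')
  finally show ?thesis .
qed

end

section \<open>Complexity\<close>

lemma adiana_eta_times_L:
  assumes "L > 0"
  shows "adiana_eta n \<omega> L * L = (if \<omega> = 0 then 1 / 2
    else min (1 / 2) (real n / (64 * \<omega> * (2 * adiana_p n \<omega> * (\<omega> + 1) + 1)\<^sup>2)))"
proof -
  have "min a c * L = min (a * L) (c * L)" for a c using assms by (simp add: min_mult_distrib_right)
  then show ?thesis using assms by (simp add: adiana_eta_def)
qed

lemma adiana_p_bounds:
  assumes "\<omega> \<ge> 0"
  shows "0 < adiana_p n \<omega>" "adiana_p n \<omega> \<le> 1"
  using assms by (auto simp: adiana_p_def less_max_iff_disj)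

lemma adiana_eta_bounds:
  assumes "n \<ge> 1" "\<omega> \<ge> 0" "L > 0"
  defines "q \<equiv> 2 * adiana_p n \<omega> * (\<omega> + 1) + 1"
  shows "0 < adiana_eta n \<omega> L" "adiana_eta n \<omega> L * L \<le> 1 / 2"
    "64 * \<omega> * q\<^sup>2 * (adiana_eta n \<omega> L * L) \<le> real n"
proof -
  have q: "q > 0" using adiana_p_bounds[of \<omega> n] assms by (simp add: add_nonneg_pos)
  have eq: "adiana_eta n \<omega> L * L = (if \<omega> = 0 then 1 / 2 else min (1 / 2) (real n / (64 * \<omega> * q\<^sup>2)))"
    unfolding q_def by (rule adiana_eta_times_L[OF assms(3)])
  have "0 < adiana_eta n \<omega> L * L" unfolding eq using assms q by auto
  then show "0 < adiana_eta n \<omega> L" using assms(3) by (simp add: zero_less_mult_iff)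
  show "adiana_eta n \<omega> L * L \<le> 1 / 2" unfolding eq
    by (cases "\<omega> = 0") (simp_all only: if_True if_False min.cobounded1 order_refl simp_thms)
  show "64 * \<omega> * q\<^sup>2 * (adiana_eta n \<omega> L * L) \<le> real n"
  proof (cases "\<omega> = 0")
    case False
    then have c: "64 * \<omega> * q\<^sup>2 > 0" using assms q by simp
    have "64 * \<omega> * q\<^sup>2 * (adiana_eta n \<omega> L * L) \<le> 64 * \<omega> * q\<^sup>2 * (real n / (64 * \<omega> * q\<^sup>2))"
      unfolding eq using c False by (intro mult_left_mono) auto
    also have "\<dots> = real n"
      using c by (metis less_irrefl nonzero_mult_div_cancel_left times_divide_eq_right)
    finally show ?thesis .
  qed simp
qed

text \<open>
  The factor \<open>u v\<close> with \<open>u = 1 / p\<close> and \<open>v = 1 / (\<eta> L)\<close> determines the accelerated part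
  \<open>1 / sqrt (\<eta> \<mu> p)\<close> of the complexity.
\<close>

lemma adiana_parameter_factor:
  assumes n: "n \<ge> 1" and omega: "\<omega> \<ge> 0" and L: "L > 0"
  defines "u \<equiv> 1 / adiana_p n \<omega>" and "v \<equiv> 1 / (adiana_eta n \<omega> L * L)"
  shows "u \<le> 3 + 2 * \<omega>"
    and "real n \<le> \<omega> \<Longrightarrow> u * v \<le> 1024 * \<omega>\<^sup>2 / real n"
    and "\<omega> < real n \<Longrightarrow> u * v \<le> 10000 * (1 + sqrt (\<omega> / real n) * \<omega>)"
proof -
  define q where "q = 2 * adiana_p n \<omega> * (\<omega> + 1) + 1"
  \<comment> \<open>The maximum in \<open>p\<close> equals 1 exactly when \<open>s \<le> 2\<close>,
    which separates the two regimes below.\<close>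
  define s where "s = sqrt (real n / (32 * \<omega>))"
  have eta: "adiana_eta n \<omega> L * L = (if \<omega> = 0 then 1 / 2 else min (1 / 2) (real n / (64 * \<omega> * q\<^sup>2)))"
    unfolding q_def by (rule adiana_eta_times_L[OF L])
  have small: "u = 2 * (1 + \<omega>)" "v = max 2 (256 * \<omega> / real n)" if "\<omega> > 0" "s \<le> 2"
  proof -
    have "1 / (2 * (1 + \<omega>)) \<le> 1" using that by (simp add: field_simps)
    then have p: "adiana_p n \<omega> = 1 / (2 * (1 + \<omega>))" using that by (simp add: adiana_p_def flip: s_def)
    then show "u = 2 * (1 + \<omega>)" by (simp add: u_def)
    have "q = 2" using p omega by (simp add: q_def field_simps)
    then have "v = 1 / min (1 / 2) (real n / (256 * \<omega>))" using that by (simp add: v_def eta)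
    also have "\<dots> = max 2 (256 * \<omega> / real n)" using that n by (auto simp: min_def max_def field_simps)
    finally show "v = max 2 (256 * \<omega> / real n)" .
  qed
  \<comment> \<open>For \<open>s > 2\<close> the choice of \<open>p\<close> keeps
    \<open>q \<le> s\<close>, hence \<open>64 * \<omega> * q\<^sup>2 \<le> 2 * n\<close>, and the
    minimum in \<open>\<eta>\<close> is \<open>1 / (2 * L)\<close>.\<close>
  have large: "u \<le> 1 + 4 * (1 + \<omega>) / s" "v = 2" if "\<omega> > 0" "s > 2"
  proof -
    define m where "m = s - 1"
    have m: "m \<ge> s / 2" "m > 1" using that by (auto simp: m_def)
    have p: "adiana_p n \<omega> = min 1 (m / (2 * (1 + \<omega>)))"
      using that m by (simp add: adiana_p_def m_def flip: s_def)
    have "u \<le> 1 + 2 * (1 + \<omega>) / m"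
      unfolding u_def p using m that by (auto simp: min_def)
    also have "\<dots> \<le> 1 + 2 * (1 + \<omega>) / (s / 2)"
      using m that by (intro add_left_mono divide_left_mono) auto
    finally show "u \<le> 1 + 4 * (1 + \<omega>) / s" by simp
    have "2 * adiana_p n \<omega> * (\<omega> + 1) \<le> 2 * (m / (2 * (1 + \<omega>))) * (\<omega> + 1)"
      unfolding p using that by (intro mult_right_mono mult_left_mono) auto
    also have "\<dots> = m"
    proof -
      have "2 * (m / (2 * a)) * a = m" if "a \<noteq> 0" for a using that by simp
      from this[of "1 + \<omega>"] show ?thesis using that by (simp only: add.commute)
    qed
    finally have "q \<le> s" by (simp add: q_def m_def)
    moreover have q: "q > 0" using adiana_p_bounds[OF omega, of n] omega by (simp add: q_def add_nonneg_pos)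
    ultimately have "q\<^sup>2 \<le> s\<^sup>2" by (intro power_mono) auto
    also have "s\<^sup>2 = real n / (32 * \<omega>)" using that by (simp add: s_def)
    finally have "64 * \<omega> * q\<^sup>2 \<le> 2 * real n" using that by (simp add: field_simps)
    then have "1 / 2 \<le> real n / (64 * \<omega> * q\<^sup>2)" using that q by (simp add: field_simps)
    then show "v = 2" using that by (simp add: v_def eta)
  qed
  have zero: "u = 1" "v = 2" if "\<omega> = 0"
    unfolding u_def v_def eta using that by (auto simp: adiana_p_def)
  show "u \<le> 3 + 2 * \<omega>"
  proof -
    consider "\<omega> = 0" | "\<omega> > 0" "s \<le> 2" | "\<omega> > 0" "s > 2" using omega by fastforce
    then show ?thesis
    proof cases
      case 3
      note large(1)[OF 3]
      also have "1 + 4 * (1 + \<omega>) / s \<le> 1 + 4 * (1 + \<omega>) / 2"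
        using 3 by (intro add_left_mono divide_left_mono) auto
      finally show ?thesis by argo
    qed (use zero small in auto)
  qed
  show "u * v \<le> 1024 * \<omega>\<^sup>2 / real n" if le: "real n \<le> \<omega>"
  proof -
    have w: "\<omega> \<ge> 1" using le n by linarith
    have "real n / (32 * \<omega>) \<le> 2\<^sup>2" using le w by (simp add: field_simps)
    then have "s \<le> 2" unfolding s_def by (rule real_le_lsqrt[rotated]) simp
    with small w have uv: "u = 2 * (1 + \<omega>)" "v = max 2 (256 * \<omega> / real n)" by auto
    have "v = 256 * \<omega> / real n" unfolding uv using le n by (simp add: field_simps max_def)
    moreover have "u \<le> 4 * \<omega>" unfolding uv using w by simp
    ultimately have "u * v \<le> 4 * \<omega> * (256 * \<omega> / real n)"
      using w by (simp only:) (intro mult_right_mono, auto)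
    then show ?thesis by (simp add: power2_eq_square)
  qed
  show "u * v \<le> 10000 * (1 + sqrt (\<omega> / real n) * \<omega>)" if less: "\<omega> < real n"
  proof -
    consider "\<omega> = 0" | "\<omega> > 0" "s \<le> 2" | "\<omega> > 0" "s > 2" using omega by fastforce
    then show ?thesis
    proof cases
      case 2
      \<comment> \<open>Here \<open>\<omega> / n\<close> is at least 1/128, so the term linear in
        \<open>\<omega>\<close> is absorbed by
        \<open>sqrt (\<omega> / n) * \<omega>\<close>.\<close>
      have "s\<^sup>2 \<le> 2\<^sup>2" using 2 by (intro power_mono) (auto simp: s_def)
      then have "real n \<le> 128 * \<omega>" using 2 by (simp add: s_def field_simps)
      then have "(1 / 12)\<^sup>2 \<le> \<omega> / real n" using n by (simp add: field_simps power2_eq_square)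
      then have "1 / 12 \<le> sqrt (\<omega> / real n)" by (rule real_le_rsqrt)
      then have "1 / 12 * \<omega> \<le> sqrt (\<omega> / real n) * \<omega>" using omega by (intro mult_right_mono)
      moreover have "v \<le> 256" using small[OF 2] less n by (simp add: field_simps)
      then have "u * v \<le> u * 256" using small[OF 2] omega by (intro mult_left_mono) auto
      then have "u * v \<le> 512 + 512 * \<omega>" using small(1)[OF 2] by simp
      moreover have "0 \<le> sqrt (\<omega> / real n) * \<omega>" using omega by simp
      ultimately show ?thesis by argo
    next
      case 3
      have "1 / s = sqrt (32 * \<omega> / real n)" using 3 n by (simp add: s_def real_sqrt_divide)
      also have "\<dots> = sqrt 32 * sqrt (\<omega> / real n)" by (simp flip: real_sqrt_mult)
      also have "\<dots> \<le> 6 * sqrt (\<omega> / real n)"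
        by (intro mult_right_mono real_le_lsqrt) (use omega in auto)
      finally have "1 / s \<le> 6 * sqrt (\<omega> / real n)" .
      then have "1 / s * \<omega> \<le> 6 * sqrt (\<omega> / real n) * \<omega>" using omega by (intro mult_right_mono)
      moreover have "1 / s \<le> 1 / 2" using 3 by (simp add: field_simps)
      moreover have "1 + 4 * (1 + \<omega>) / s = 1 + 4 * (1 / s) + 4 * (1 / s * \<omega>)"
        by (simp add: add_divide_distrib)
      ultimately have "1 + 4 * (1 + \<omega>) / s \<le> 3 + 24 * (sqrt (\<omega> / real n) * \<omega>)" by argo
      with large[OF 3] have "u * v \<le> 6 + 48 * (sqrt (\<omega> / real n) * \<omega>)" by simp
      moreover have "0 \<le> sqrt (\<omega> / real n) * \<omega>" using omega by simp
      ultimately show ?thesis by simp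
    qed (use zero omega in auto)
  qed
qed

section \<open>From the contraction factor to the number of iterations\<close>

definition adiana_complexity :: "nat \<Rightarrow> real \<Rightarrow> real \<Rightarrow> real \<Rightarrow> real" where
  "adiana_complexity n \<omega> L \<mu> =
    (if real n \<le> \<omega>
     then \<omega> + \<omega> * sqrt (L / (real n * \<mu>))
     else \<omega> + sqrt (L / \<mu>) + sqrt (sqrt (\<omega> / real n) * (\<omega> * L / \<mu>)))"

text \<open>The reciprocal of the minimum is at most the sum of both reciprocals, and
  \<open>1 / (p * \<theta>) \<le> 4 * u + W\<close> with
  \<open>W = 1 / sqrt (\<eta> * \<mu> * p)\<close>. Additive constants are absorbed by
  \<open>\<omega> \<ge> 1\<close> if \<open>n \<le> \<omega>\<close>, and by
  \<open>sqrt (L / \<mu>) \<ge> 1\<close> otherwise.\<close>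

lemma adiana_rate:
  assumes n: "n \<ge> 1" and omega: "\<omega> \<ge> 0" and mu: "0 < \<mu>" "\<mu> \<le> L"
    and p: "p = adiana_p n \<omega>" and eta: "\<eta> = adiana_eta n \<omega> L"
    and theta: "\<theta> = min (1 / 4) (sqrt (\<eta> * \<mu> / p))"
  shows "3 / min (2 / 5 * p * \<theta>) (1 / (4 * (\<omega> + 1))) \<le> 10 ^ 6 * adiana_complexity n \<omega> L \<mu>"
proof -
  have L: "L > 0" using mu by simp
  define u v where "u = 1 / p" and "v = 1 / (\<eta> * L)"
  define k where "k = L / \<mu>"
  define W where "W = sqrt (k * (u * v))"
  have k1: "k \<ge> 1" using mu by (simp add: k_def)
  have pos: "p > 0" "\<eta> > 0" using adiana_p_bounds[OF omega] adiana_eta_bounds[OF n omega L] by (auto simp: p eta)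
  note uv = adiana_parameter_factor[OF n omega L, folded p eta, folded u_def v_def]
  have th: "\<theta> > 0" using pos mu by (simp add: theta)
  have "1 / (p * \<theta>) \<le> 4 * u + W"
  proof (cases "1 / 4 \<le> sqrt (\<eta> * \<mu> / p)")
    case True
    then have "1 / (p * \<theta>) = 4 * u" by (simp add: theta u_def)
    moreover have "0 \<le> W" using pos k1 L by (simp add: W_def u_def v_def)
    ultimately show ?thesis by simp
  next
    case False
    then have "\<theta> = sqrt (\<eta> * \<mu> / p)" by (simp add: theta)
    then have "p * \<theta> = sqrt (p\<^sup>2 * (\<eta> * \<mu> / p))" using pos by (subst real_sqrt_mult) simp
    also have "p\<^sup>2 * (\<eta> * \<mu> / p) = 1 / (k * (u * v))"
      using pos L mu by (simp add: k_def u_def v_def power2_eq_square)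
    finally have "1 / (p * \<theta>) = W" by (simp add: W_def real_sqrt_divide)
    then show ?thesis using pos by (simp add: u_def)
  qed
  then have 1: "3 / (2 / 5 * p * \<theta>) \<le> 30 * u + 15 / 2 * W" by (simp add: field_simps)
  have "3 / min (2 / 5 * p * \<theta>) (1 / (4 * (\<omega> + 1))) \<le> 3 / (2 / 5 * p * \<theta>) + 12 * (\<omega> + 1)"
    using pos th omega by (auto simp: min_def)
  also have "\<dots> \<le> 102 + 72 * \<omega> + 15 / 2 * W" using 1 uv(1) by simp
  finally have total: "3 / min (2 / 5 * p * \<theta>) (1 / (4 * (\<omega> + 1))) \<le> 102 + 72 * \<omega> + 15 / 2 * W" .
  show ?thesis
  proof (cases "real n \<le> \<omega>")
    case True
    then have w: "\<omega> \<ge> 1" using n by linarith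
    have "k * (u * v) \<le> k * (1024 * \<omega>\<^sup>2 / real n)"
      using uv(2)[OF True] k1 by (intro mult_left_mono) auto
    then have "W \<le> sqrt (k * (1024 * \<omega>\<^sup>2 / real n))" unfolding W_def by simp
    also have "\<dots> = sqrt ((32 * \<omega>)\<^sup>2 * (L / (real n * \<mu>)))"
      by (simp add: k_def power_mult_distrib mult_ac)
    also have "\<dots> = 32 * \<omega> * sqrt (L / (real n * \<mu>))" using omega by (subst real_sqrt_mult, subst real_sqrt_abs) simp
    finally have "W \<le> 32 * (\<omega> * sqrt (L / (real n * \<mu>)))" by simp
    moreover have "0 \<le> \<omega> * sqrt (L / (real n * \<mu>))" using omega L mu by simp
    ultimately show ?thesis using total w True by (simp add: adiana_complexity_def)
  next
    case False
    define Y where "Y = sqrt (sqrt (\<omega> / real n) * (\<omega> * L / \<mu>))"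
    have nn: "0 \<le> sqrt (\<omega> / real n) * (\<omega> * L / \<mu>)" using omega L mu by simp
    have "k * (u * v) \<le> k * (10000 * (1 + sqrt (\<omega> / real n) * \<omega>))"
      using uv(3) False k1 by (intro mult_left_mono) auto
    also have "\<dots> = 100\<^sup>2 * (k + sqrt (\<omega> / real n) * (\<omega> * L / \<mu>))" by (simp add: k_def algebra_simps)
    finally have "W \<le> sqrt (100\<^sup>2 * (k + sqrt (\<omega> / real n) * (\<omega> * L / \<mu>)))" unfolding W_def by simp
    also have "\<dots> = 100 * sqrt (k + sqrt (\<omega> / real n) * (\<omega> * L / \<mu>))"
      by (simp only: real_sqrt_mult) simp
    also have "\<dots> \<le> 100 * (sqrt k + Y)"
      unfolding Y_def using sqrt_add_le_add_sqrt[OF _ nn, of k] k1 by (intro mult_left_mono) auto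
    finally have "W \<le> 100 * (sqrt k + Y)" .
    moreover have "1 \<le> sqrt k" "0 \<le> Y" using k1 nn by (auto simp: Y_def)
    ultimately have "102 + 72 * \<omega> + 15 / 2 * W \<le> 1000000 * (\<omega> + sqrt k + Y)"
      using omega by argo
    also have "\<dots> = 10 ^ 6 * adiana_complexity n \<omega> L \<mu>"
      using False by (simp add: adiana_complexity_def k_def Y_def)
    finally have "102 + 72 * \<omega> + 15 / 2 * W \<le> 10 ^ 6 * adiana_complexity n \<omega> L \<mu>" .
    with total show ?thesis by (rule order_trans)
  qed
qed

text \<open>For small \<open>\<epsilon>\<close> the logarithm of \<open>(D + 1) / \<epsilon>\<close>
  is at most twice that of \<open>1 / \<epsilon>\<close>, so \<open>D\<close> affects only the
  threshold. Rounding up costs at most one more multiple of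
  \<open>ln (1 / \<epsilon>) / \<rho>\<close>, which makes the constant 3.\<close>

lemma geometric_decay_iterations:
  fixes \<rho> D :: real and E :: "nat \<Rightarrow> ennreal"
  assumes rho: "0 < \<rho>" "\<rho> \<le> 1" and D: "0 \<le> D" and E: "\<And>k. E k \<le> ennreal ((1 - \<rho>) ^ k * D)"
    and c: "3 / \<rho> \<le> c"
  shows "\<exists>\<epsilon>\<^sub>0>0. \<forall>\<epsilon>. 0 < \<epsilon> \<and> \<epsilon> < \<epsilon>\<^sub>0 \<longrightarrow>
    (\<exists>K :: nat. real K \<le> c * ln (1 / \<epsilon>) \<and> (\<forall>k\<ge>K. E k \<le> ennreal \<epsilon>))"
\<comment> \<open>The first bound ensures \<open>ln (1 / \<epsilon>) \<ge> 1\<close>, the second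
  \<open>ln (D + 1) \<le> ln (1 / \<epsilon>)\<close>; using \<open>D + 1\<close> covers
  \<open>D = 0\<close>.\<close>
proof (intro exI[of _ "min (exp (- 1)) (1 / (D + 1))"] conjI allI impI)
  show "0 < min (exp (- 1)) (1 / (D + 1))" using D by simp
  fix \<epsilon> :: real assume eps: "0 < \<epsilon> \<and> \<epsilon> < min (exp (- 1)) (1 / (D + 1))"
  define l where "l = ln (1 / \<epsilon>)"
  define t where "t = 1 / \<rho> * ln ((D + 1) / \<epsilon>)"
  have "ln \<epsilon> < - 1" using eps by (metis exp_less_cancel_iff exp_ln min_less_iff_conj)
  then have l: "l \<ge> 1" using eps by (simp add: l_def ln_div)
  have "D + 1 \<le> 1 / \<epsilon>" using eps D by (simp add: field_simps)
  then have "ln (D + 1) \<le> l" unfolding l_def using D eps by (subst ln_le_cancel_iff) auto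
  moreover have "ln ((D + 1) / \<epsilon>) = ln (D + 1) + l" using eps D by (simp add: l_def ln_div)
  ultimately have "ln ((D + 1) / \<epsilon>) \<le> 2 * l" "0 \<le> ln ((D + 1) / \<epsilon>)" using l D by auto
  then have t: "0 \<le> t" "t \<le> 1 / \<rho> * (2 * l)"
    using rho unfolding t_def by (auto intro: mult_left_mono divide_right_mono)
  show "\<exists>K :: nat. real K \<le> c * ln (1 / \<epsilon>) \<and> (\<forall>k\<ge>K. E k \<le> ennreal \<epsilon>)"
  proof (intro exI[of _ "nat \<lceil>t\<rceil>"] conjI allI impI)
    have "real (nat \<lceil>t\<rceil>) \<le> t + 1" using t by linarith
    also have "\<dots> \<le> 1 / \<rho> * (2 * l) + 1 / \<rho> * l"
    proof (rule add_mono[OF t(2)])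
      show "1 \<le> 1 / \<rho> * l" using rho l by (simp add: pos_le_divide_eq)
    qed
    also have "\<dots> = 3 / \<rho> * l" by (simp add: field_simps)
    also have "\<dots> \<le> c * l" using c l by (intro mult_right_mono) auto
    finally show "real (nat \<lceil>t\<rceil>) \<le> c * ln (1 / \<epsilon>)" by (simp add: l_def)
    fix k assume k: "nat \<lceil>t\<rceil> \<le> k"
    have "(1 - \<rho>) ^ k \<le> exp (- \<rho>) ^ k"
      using rho exp_ge_add_one_self[of "- \<rho>"] by (intro power_mono) auto
    also have "\<dots> = exp (- (\<rho> * real k))" by (simp add: mult.commute flip: exp_of_nat_mult)
    also have "\<dots> \<le> exp (- ln ((D + 1) / \<epsilon>))"
    proof -
      have "t \<le> real k" using k by linarith
      then have "\<rho> * t \<le> \<rho> * real k" using rho by (intro mult_left_mono) auto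
      then show ?thesis using rho by (simp add: t_def)
    qed
    also have "\<dots> = \<epsilon> / (D + 1)" using eps D by (simp add: exp_minus)
    finally have "(1 - \<rho>) ^ k * D \<le> \<epsilon> / (D + 1) * D" using D by (intro mult_right_mono)
    also have "\<dots> \<le> \<epsilon>" using eps D by (simp add: field_simps)
    finally show "E k \<le> ennreal \<epsilon>" using E[of k] ennreal_leI order_trans by blast
  qed
qed

text \<open>The constant hidden in the O-notation is absolute; only the threshold for
  \<open>\<epsilon>\<close> depends on the problem and the starting point.\<close>

theorem theorem4:
  fixes M :: "'w measure" and S :: "nat \<Rightarrow> nat \<Rightarrow> 's measure"
    and \<xi> :: "nat \<Rightarrow> nat \<Rightarrow> 'w \<Rightarrow> 's" and b :: "nat \<Rightarrow> 'w \<Rightarrow> bool"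
    and C :: "nat \<Rightarrow> nat \<Rightarrow> 's \<Rightarrow> 'a::euclidean_space \<Rightarrow> 'a"
    and f :: "nat \<Rightarrow> 'a \<Rightarrow> real" and gradf :: "nat \<Rightarrow> 'a \<Rightarrow> 'a" and \<psi> :: "'a \<Rightarrow> ereal"
    and x0 xstar :: 'a and h0 :: "nat \<Rightarrow> 'a"
    and n :: nat and L \<mu> \<omega> \<eta> \<theta>\<^sub>1 \<theta>\<^sub>2 \<alpha> \<beta> \<gamma> p :: real
  assumes "n \<ge> 1" and "\<mu> > 0" and "\<omega> \<ge> 0"
    and "\<And>i x. i < n \<Longrightarrow> GDERIV (f i) x :> gradf i x"
    and "\<And>i. i < n \<Longrightarrow> L-lipschitz_on UNIV (gradf i)"
    and "\<And>i. i < n \<Longrightarrow> convex_on UNIV (f i)"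
    and "strongly_convex \<mu> (\<lambda>x. (1 / real n) * (\<Sum>i<n. f i x))
           (\<lambda>x. (1 / real n) *\<^sub>R (\<Sum>i<n. gradf i x))"
    and "proper_closed_convex \<psi>"
    and "is_arg_min (\<lambda>x. ereal ((1 / real n) * (\<Sum>i<n. f i x)) + \<psi> x) (\<lambda>_. True) xstar"
    and "prob_space M"
    and "independent_randomness M n S \<xi> b"
    and "\<And>i k. i < n \<Longrightarrow> (\<lambda>(s, v). C i k s v) \<in> borel_measurable (S i k \<Otimes>\<^sub>M borel)"
    and "\<And>i k. i < n \<Longrightarrow> compression_operator \<omega> M (\<lambda>s. C i k (\<xi> i k s))"
    and "\<And>k. measure M {s \<in> space M. b k s} = p"
    and "p = adiana_p n \<omega>"
    and "\<eta> = adiana_eta n \<omega> L"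
    and "\<theta>\<^sub>1 = min (1 / 4) (sqrt (\<eta> * \<mu> / p))"
    and "\<theta>\<^sub>2 = 1 / 2"
    and "\<alpha> = 1 / (\<omega> + 1)"
    and "\<gamma> = \<eta> / (2 * (\<theta>\<^sub>1 + \<eta> * \<mu>))"
    and "\<beta> = 1 - \<gamma> * \<mu>"
  shows "\<exists>\<epsilon>\<^sub>0>0. \<forall>\<epsilon>. 0 < \<epsilon> \<and> \<epsilon> < \<epsilon>\<^sub>0 \<longrightarrow>
    (\<exists>K :: nat.
       real K \<le> 10 ^ 6 *
         (if real n \<le> \<omega>
          then \<omega> + \<omega> * sqrt (L / (real n * \<mu>))
          else \<omega> + sqrt (L / \<mu>) + sqrt (sqrt (\<omega> / real n) * (\<omega> * L / \<mu>))) * ln (1 / \<epsilon>) \<and>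
       (\<forall>k\<ge>K.
         (\<integral>\<^sup>+s. ennreal ((norm (zvec (adiana n gradf \<psi> \<eta> \<theta>\<^sub>1 \<theta>\<^sub>2 \<alpha> \<beta> \<gamma>
              (\<lambda>i k. C i k (\<xi> i k s)) (\<lambda>k. b k s) x0 h0 k) - xstar))\<^sup>2) \<partial>M) \<le> ennreal \<epsilon>))"
proof -
  interpret adiana_problem f gradf \<psi> xstar n L \<mu>
    by unfold_locales (use assms in auto)
  have p: "0 < p" "p \<le> 1" using adiana_p_bounds[OF \<open>\<omega> \<ge> 0\<close>] assms(15) by auto
  note eta = adiana_eta_bounds[OF \<open>n \<ge> 1\<close> \<open>\<omega> \<ge> 0\<close> L_pos, folded \<open>p = adiana_p n \<omega>\<close> \<open>\<eta> = adiana_eta n \<omega> L\<close>]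
  have theta: "0 < \<theta>\<^sub>1" "\<theta>\<^sub>1 \<le> 1 / 4" using assms(17) p eta mu by auto
  have "\<theta>\<^sub>1\<^sup>2 \<le> (sqrt (\<eta> * \<mu> / p))\<^sup>2" using theta assms(17) by (intro power_mono) auto
  then have theta_le: "p * \<theta>\<^sub>1\<^sup>2 \<le> \<eta> * \<mu>" using p eta mu by (simp add: field_simps)
  interpret prob_space M by fact
  interpret adiana_run f gradf \<psi> xstar n L \<mu> \<omega> \<eta> \<theta>\<^sub>1 p \<gamma> M S \<xi> b C x0 h0
    by unfold_locales (use assms p eta theta theta_le in auto)
  have "3 / rho \<le> 10 ^ 6 * adiana_complexity n \<omega> L \<mu>"
    unfolding rho_def
    by (rule adiana_rate[OF \<open>n \<ge> 1\<close> \<open>\<omega> \<ge> 0\<close> mu mu_le_L assms(15-17)])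
  moreover have "(\<integral>\<^sup>+s. ennreal ((norm (zvec (adiana n gradf \<psi> \<eta> \<theta>\<^sub>1 \<theta>\<^sub>2 \<alpha> \<beta> \<gamma>
        (\<lambda>i k. C i k (\<xi> i k s)) (\<lambda>k. b k s) x0 h0 k) - xstar))\<^sup>2) \<partial>M) \<le> ennreal ((1 - rho) ^ k * initial_bound)" for k
    using expected_distance[of k] by (simp add: iterate_def assms(18,19,21))
  ultimately show ?thesis
    using geometric_decay_iterations[OF rho_bounds(1) _ initial_bound_nonneg] rho_bounds(4)
    unfolding adiana_complexity_def by fastforce
qed

end
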